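(* Let $\mathbb{H}$ and $\mathbb{K}$ be complex Hilbert spaces, and let $A$ be a bounded linear operator on $\mathbb{H}$ and $B$ a bounded linear operator on $\mathbb{K}$. Then $$w(A \otimes B) \leq \min\left\{w(A)\big(w(B)+d(B)\big),\; w(B)\big(w(A)+d(A)\big)\right\} \leq 2w(A)w(B).$$
   Context: For a bounded linear operator $T$ on a complex Hilbert space with inner product $\langle\cdot,\cdot\rangle$, the numerical radius is $w(T)=\sup\{|\langle Tx,x\rangle| : \|x\|=1\}$. The numerical radius distance of $T$ from the scalar operators is $d(T)=\inf\{w(T-\lambda I):\lambda\in\mathbb{C}\}$, where $I$ is the identity operator on the space on which $T$ acts. $\mathbb{H}\otimes\mathbb{K}$ is the Hilbert space tensor product (the completion of the algebraic tensor product under the inner product determined by $\langle x\otimes y,z\otimes u\rangle=\langle x,z\rangle\langle y,u\rangle$), and $A\otimes B$ is the bounded linear operator on $\mathbb{H}\otimes\mathbb{K}$ determined by $(A\otimes B)(x\otimes y)=Ax\otimes By$. *)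

theory Defs
  imports "HOL-Analysis.Analysis"
begin

section \<open>Complex Hilbert spaces\<close>

class scaleC = scaleR +
  fixes scaleC :: "complex \<Rightarrow> 'a \<Rightarrow> 'a" (infixr "*\<^sub>C" 75)
  assumes scaleR_scaleC: "scaleR r = scaleC (complex_of_real r)"

class complex_vector = scaleC + ab_group_add +
  assumes scaleC_add_right: "a *\<^sub>C (x + y) = a *\<^sub>C x + a *\<^sub>C y"
    and scaleC_add_left: "(a + b) *\<^sub>C x = a *\<^sub>C x + b *\<^sub>C x"
    and scaleC_scaleC: "a *\<^sub>C b *\<^sub>C x = (a * b) *\<^sub>C x"
    and scaleC_one: "1 *\<^sub>C x = x"
begin

subclass real_vector
  by unfold_locales
    (simp_all add: scaleR_scaleC scaleC_add_right scaleC_add_left scaleC_scaleC scaleC_one)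

lemma scaleC_zero_left [simp]: "0 *\<^sub>C x = 0"
  using scaleC_add_left[of 0 0 x] by simp

lemma scaleC_zero_right [simp]: "a *\<^sub>C 0 = 0"
  using scaleC_add_right[of a 0 0] by simp

lemma scaleC_minus_one: "(- 1) *\<^sub>C x = - x"
proof -
  have "(- 1) *\<^sub>C x + x = 0"
    using scaleC_add_left[of "-1" 1 x] by (simp add: scaleC_one)
  thus ?thesis by (simp add: eq_neg_iff_add_eq_0)
qed

end

text \<open>The inner product is linear in the first argument.\<close>

class cinner_vector = complex_vector +
  fixes cinner :: "'a \<Rightarrow> 'a \<Rightarrow> complex"
  assumes cinner_commute: "cinner x y = cnj (cinner y x)"
    and cinner_add_left: "cinner (x + y) z = cinner x z + cinner y z"
    and cinner_scaleC_left: "cinner (a *\<^sub>C x) y = a * cinner x y"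
    and cinner_self_ge_zero: "0 \<le> Re (cinner x x)"
    and cinner_self_eq_zero_iff: "cinner x x = 0 \<longleftrightarrow> x = 0"
begin

definition cinner_norm :: "'a \<Rightarrow> real" where
  "cinner_norm x = sqrt (Re (cinner x x))"

lemma cinner_zero_left [simp]: "cinner 0 x = 0"
  using cinner_scaleC_left[of 0 0 x] by simp

lemma cinner_minus_left: "cinner (- x) y = - cinner x y"
  using cinner_scaleC_left[of "-1" x y] by (simp add: scaleC_minus_one)

lemma cinner_diff_left: "cinner (x - y) z = cinner x z - cinner y z"
  using cinner_add_left[of x "- y" z] by (simp add: cinner_minus_left)

lemma cinner_add_right: "cinner x (y + z) = cinner x y + cinner x z"
  by (metis cinner_add_left cinner_commute complex_cnj_add)

lemma cinner_scaleC_right: "cinner x (a *\<^sub>C y) = cnj a * cinner x y"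
  by (metis cinner_scaleC_left cinner_commute complex_cnj_mult)

lemma cinner_zero_right [simp]: "cinner x 0 = 0"
  by (metis cinner_zero_left cinner_commute complex_cnj_zero)

lemma cinner_minus_right: "cinner x (- y) = - cinner x y"
  by (metis cinner_minus_left cinner_commute complex_cnj_minus)

lemma cinner_diff_right: "cinner x (y - z) = cinner x y - cinner x z"
  by (metis cinner_diff_left cinner_commute complex_cnj_diff)

lemma cinner_norm_sq_cinner: "complex_of_real ((cinner_norm x)\<^sup>2) = cinner x x"
proof -
  have "Im (cinner x x) = 0"
    using arg_cong[OF cinner_commute[of x x], of Im] by simp
  thus ?thesis
    by (simp add: complex_eq_iff cinner_norm_def cinner_self_ge_zero)
qed

lemma cinner_norm_sq_Re_cinner: "(cinner_norm x)\<^sup>2 = Re (cinner x x)"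
  by (simp add: cinner_norm_def cinner_self_ge_zero)

lemma cinner_norm_nonneg: "0 \<le> cinner_norm x"
  by (simp add: cinner_norm_def cinner_self_ge_zero)

lemma cinner_norm_Cauchy_Schwarz: "cmod (cinner x y) \<le> cinner_norm x * cinner_norm y"
proof (cases "y = 0")
  case True
  thus ?thesis by (simp add: cinner_norm_def)
next
  case False
  define n where "n = (cinner_norm y)\<^sup>2"
  have yy: "cinner y y = complex_of_real n"
    unfolding n_def by (rule cinner_norm_sq_cinner[symmetric])
  have "n \<noteq> 0"
  proof
    assume "n = 0"
    hence "cinner y y = 0" unfolding yy by simp
    thus False using False by (simp only: cinner_self_eq_zero_iff)
  qed
  hence n: "n > 0" unfolding n_def by (simp add: less_le)
  define c where "c = cinner x y / complex_of_real n"
  have cxy: "cinner y x = cnj (cinner x y)" by (rule cinner_commute)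
  have "cinner (x - c *\<^sub>C y) (x - c *\<^sub>C y) =
      cinner x x - cnj c * cinner x y - c * cnj (cinner x y) + c * cnj c * complex_of_real n"
    unfolding cinner_diff_left cinner_diff_right cinner_scaleC_left cinner_scaleC_right yy cxy
    by (simp only: algebra_simps)
  also have "\<dots> = cinner x x - cinner x y * cnj (cinner x y) / complex_of_real n"
    using n by (simp add: c_def field_simps)
  also have "\<dots> = complex_of_real ((cinner_norm x)\<^sup>2 - (cmod (cinner x y))\<^sup>2 / n)"
    unfolding of_real_diff of_real_divide cinner_norm_sq_cinner complex_norm_square ..
  finally have "(cinner_norm x)\<^sup>2 - (cmod (cinner x y))\<^sup>2 / n \<ge> 0"
    using cinner_self_ge_zero[of "x - c *\<^sub>C y"] by simp
  hence "(cmod (cinner x y))\<^sup>2 \<le> (cinner_norm x * cinner_norm y)\<^sup>2"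
    using n unfolding n_def by (simp add: field_simps power_mult_distrib)
  thus ?thesis
    by (rule power2_le_imp_le) (simp add: cinner_norm_nonneg)
qed

lemma cinner_norm_eq_0: "cinner_norm x = 0 \<longleftrightarrow> x = 0"
  by (metis cinner_norm_sq_cinner cinner_self_eq_zero_iff of_real_eq_0_iff zero_eq_power2)

lemma cinner_norm_triangle: "cinner_norm (x + y) \<le> cinner_norm x + cinner_norm y"
proof -
  have "(cinner_norm (x + y))\<^sup>2 = (cinner_norm x)\<^sup>2 + (cinner_norm y)\<^sup>2 + 2 * Re (cinner x y)"
    using arg_cong[OF cinner_commute[of y x], of Re]
    by (simp add: cinner_norm_sq_Re_cinner cinner_add_left cinner_add_right)
  also have "Re (cinner x y) \<le> cinner_norm x * cinner_norm y"
    using cinner_norm_Cauchy_Schwarz complex_Re_le_cmod order_trans by blast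
  finally have "(cinner_norm (x + y))\<^sup>2 \<le> (cinner_norm x + cinner_norm y)\<^sup>2"
    by (simp add: power2_sum)
  thus ?thesis
    by (rule power2_le_imp_le) (simp add: cinner_norm_nonneg)
qed

lemma cinner_norm_scaleC: "cinner_norm (a *\<^sub>C x) = cmod a * cinner_norm x"
proof -
  have "complex_of_real ((cinner_norm (a *\<^sub>C x))\<^sup>2) = (a * cnj a) * cinner x x"
    unfolding cinner_norm_sq_cinner by (simp add: cinner_scaleC_left cinner_scaleC_right)
  also have "\<dots> = complex_of_real ((cmod a * cinner_norm x)\<^sup>2)"
    unfolding power_mult_distrib of_real_mult cinner_norm_sq_cinner complex_norm_square ..
  finally have "complex_of_real ((cinner_norm (a *\<^sub>C x))\<^sup>2) =
      complex_of_real ((cmod a * cinner_norm x)\<^sup>2)" .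
  hence "(cinner_norm (a *\<^sub>C x))\<^sup>2 = (cmod a * cinner_norm x)\<^sup>2"
    by (simp only: of_real_eq_iff)
  thus ?thesis
    by (rule power2_eq_imp_eq) (simp_all add: cinner_norm_nonneg)
qed

end

class complex_inner = cinner_vector + real_normed_vector +
  assumes norm_eq_sqrt_cinner: "norm x = sqrt (Re (cinner x x))"
begin

lemma norm_eq_cinner_norm: "norm x = cinner_norm x"
  by (simp add: cinner_norm_def norm_eq_sqrt_cinner)

lemmas norm_sq_cinner = cinner_norm_sq_cinner[folded norm_eq_cinner_norm]
lemmas Cauchy_Schwarz_cinner = cinner_norm_Cauchy_Schwarz[folded norm_eq_cinner_norm]
lemmas norm_scaleC = cinner_norm_scaleC[folded norm_eq_cinner_norm]

end

class chilbert_space = complex_inner + complete_space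

instantiation complex :: chilbert_space
begin
definition scaleC_complex :: "complex \<Rightarrow> complex \<Rightarrow> complex" where
  "scaleC_complex a z = a * z"
definition cinner_complex :: "complex \<Rightarrow> complex \<Rightarrow> complex" where
  "cinner_complex z u = z * cnj u"
instance
  by standard
    (auto simp: scaleC_complex_def cinner_complex_def algebra_simps cmod_def power2_eq_square
      complex_eq_iff scaleR_conv_of_real)
end

definition clinear :: "('a::complex_vector \<Rightarrow> 'b::complex_vector) \<Rightarrow> bool" where
  "clinear f \<longleftrightarrow> (\<forall>x y. f (x + y) = f x + f y) \<and> (\<forall>c x. f (c *\<^sub>C x) = c *\<^sub>C f x)"

definition bounded_clinear :: "('a::complex_inner \<Rightarrow> 'b::complex_inner) \<Rightarrow> bool" where
  "bounded_clinear f \<longleftrightarrow> clinear f \<and> (\<exists>M. \<forall>x. norm (f x) \<le> M * norm x)"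

lemma clinear_simps:
  assumes "clinear f"
  shows "f (x + y) = f x + f y" "f (c *\<^sub>C x) = c *\<^sub>C f x" "f 0 = 0" "f (x - y) = f x - f y"
proof -
  show add: "f (x + y) = f x + f y" for x y using assms by (simp add: clinear_def)
  show "f (c *\<^sub>C x) = c *\<^sub>C f x" using assms by (simp add: clinear_def)
  show "f 0 = 0" using add[of 0 0] by simp
  show "f (x - y) = f x - f y" using add[of "x - y" y] by simp
qed

lemma bounded_clinear_clinear: "bounded_clinear f \<Longrightarrow> clinear f"
  by (simp add: bounded_clinear_def)

lemma bounded_clinear_bounded_linear:
  assumes "bounded_clinear f"
  shows "bounded_linear f"
proof -
  note lin = clinear_simps[OF bounded_clinear_clinear[OF assms]]
  obtain M where M: "\<And>x. norm (f x) \<le> M * norm x"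
    using assms by (auto simp: bounded_clinear_def)
  show ?thesis
    by (rule bounded_linear_intro[where K = M])
      (auto simp: lin scaleR_scaleC M mult.commute)
qed


section \<open>The algebraic tensor product\<close>

definition cbilinear :: "('a::complex_vector \<Rightarrow> 'b::complex_vector \<Rightarrow> complex) \<Rightarrow> bool" where
  "cbilinear \<beta> \<longleftrightarrow>
     (\<forall>x x' y. \<beta> (x + x') y = \<beta> x y + \<beta> x' y) \<and> (\<forall>c x y. \<beta> (c *\<^sub>C x) y = c * \<beta> x y) \<and>
     (\<forall>x y y'. \<beta> x (y + y') = \<beta> x y + \<beta> x y') \<and> (\<forall>c x y. \<beta> x (c *\<^sub>C y) = c * \<beta> x y)"

definition sum_form :: "('a \<Rightarrow> 'b \<Rightarrow> complex) \<Rightarrow> ('a \<times> 'b) list \<Rightarrow> complex" where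
  "sum_form \<beta> s = (\<Sum>(x, y)\<leftarrow>s. \<beta> x y)"

text \<open>
  A list stands for the formal sum of the elementary tensors of its entries. Two formal sums are the
  same element of the algebraic tensor product iff no bilinear form (bounded or not) tells them
  apart: the bilinear forms on a pair of vector spaces are exactly the linear functionals on their
  tensor product, and these separate points.
\<close>

definition tensor_eq ::
  "('a::complex_vector \<times> 'b::complex_vector) list \<Rightarrow> ('a \<times> 'b) list \<Rightarrow> bool" where
  "tensor_eq s t \<longleftrightarrow> (\<forall>\<beta>. cbilinear \<beta> \<longrightarrow> sum_form \<beta> s = sum_form \<beta> t)"

quotient_type (overloaded) ('a, 'b) alg_tensor =
  "('a::complex_vector \<times> 'b::complex_vector) list" / tensor_eq
  by (rule equivpI) (auto simp: reflp_def symp_def transp_def tensor_eq_def)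

lemma sum_form_Nil [simp]: "sum_form \<beta> [] = 0"
  by (simp add: sum_form_def)

lemma sum_form_Cons [simp]: "sum_form \<beta> (p # s) = \<beta> (fst p) (snd p) + sum_form \<beta> s"
  by (simp add: sum_form_def case_prod_beta)

lemma sum_form_append [simp]: "sum_form \<beta> (s @ t) = sum_form \<beta> s + sum_form \<beta> t"
  by (simp add: sum_form_def)

lemma sum_form_map: "sum_form \<beta> (map (\<lambda>(x, y). (f x, g y)) s) = sum_form (\<lambda>x y. \<beta> (f x) (g y)) s"
  by (induction s) auto

lemma sum_form_mult: "sum_form (\<lambda>x y. c * \<beta> x y) s = c * sum_form \<beta> s"
  by (induction s) (auto simp: algebra_simps)

lemma sum_form_add: "sum_form (\<lambda>x y. \<beta> x y + \<gamma> x y) s = sum_form \<beta> s + sum_form \<gamma> s"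
  by (induction s) (auto simp: algebra_simps)

lemma sum_form_cnj: "sum_form (\<lambda>x y. cnj (\<beta> x y)) s = cnj (sum_form \<beta> s)"
  by (induction s) auto

lemma cbilinear_simps:
  assumes "cbilinear \<beta>"
  shows "\<beta> (x + x') y = \<beta> x y + \<beta> x' y" "\<beta> (c *\<^sub>C x) y = c * \<beta> x y"
    "\<beta> x (y + y') = \<beta> x y + \<beta> x y'" "\<beta> x (c *\<^sub>C y) = c * \<beta> x y"
  using assms by (auto simp: cbilinear_def)

lemma sum_form_scaleC:
  assumes "cbilinear \<beta>"
  shows "sum_form \<beta> (map (\<lambda>(x, y). (c *\<^sub>C x, y)) s) = c * sum_form \<beta> s"
  by (induction s) (auto simp: cbilinear_simps[OF assms] algebra_simps)

instantiation alg_tensor :: (complex_vector, complex_vector) complex_vector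
begin

lift_definition zero_alg_tensor :: "('a, 'b) alg_tensor" is "[]" .

lift_definition plus_alg_tensor ::
  "('a, 'b) alg_tensor \<Rightarrow> ('a, 'b) alg_tensor \<Rightarrow> ('a, 'b) alg_tensor" is "(@)"
  by (simp add: tensor_eq_def)

lift_definition scaleC_alg_tensor :: "complex \<Rightarrow> ('a, 'b) alg_tensor \<Rightarrow> ('a, 'b) alg_tensor"
  is "\<lambda>c. map (\<lambda>(x, y). (c *\<^sub>C x, y))"
  by (simp add: tensor_eq_def sum_form_scaleC)

definition scaleR_alg_tensor :: "real \<Rightarrow> ('a, 'b) alg_tensor \<Rightarrow> ('a, 'b) alg_tensor" where
  "scaleR_alg_tensor r = scaleC (complex_of_real r)"

definition uminus_alg_tensor :: "('a, 'b) alg_tensor \<Rightarrow> ('a, 'b) alg_tensor" where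
  "uminus_alg_tensor t = (- 1) *\<^sub>C t"

definition minus_alg_tensor ::
  "('a, 'b) alg_tensor \<Rightarrow> ('a, 'b) alg_tensor \<Rightarrow> ('a, 'b) alg_tensor" where
  "minus_alg_tensor s t = s + (- 1) *\<^sub>C t"

instance
proof
  fix s t u :: "('a, 'b) alg_tensor" and a b :: complex and r :: real
  show "s + t + u = s + (t + u)" by transfer (simp add: tensor_eq_def)
  show "s + t = t + s" by transfer (simp add: tensor_eq_def)
  show "0 + s = s" by transfer (simp add: tensor_eq_def)
  show "- s + s = 0" unfolding uminus_alg_tensor_def
    by transfer (simp add: tensor_eq_def sum_form_scaleC)
  show "s - t = s + - t" by (simp add: uminus_alg_tensor_def minus_alg_tensor_def)
  show "scaleR r = (scaleC (complex_of_real r) :: ('a, 'b) alg_tensor \<Rightarrow> _)"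
    by (rule scaleR_alg_tensor_def)
  show "a *\<^sub>C (s + t) = a *\<^sub>C s + a *\<^sub>C t"
    by transfer (simp add: tensor_eq_def)
  show "(a + b) *\<^sub>C s = a *\<^sub>C s + b *\<^sub>C s"
    by transfer (simp add: tensor_eq_def sum_form_scaleC algebra_simps)
  show "a *\<^sub>C b *\<^sub>C s = (a * b) *\<^sub>C s"
    by transfer (simp add: tensor_eq_def sum_form_scaleC del: map_map)
  show "1 *\<^sub>C s = s"
    by transfer (simp add: tensor_eq_def sum_form_scaleC)
qed

end

lift_definition alg_elem_tensor :: "'a::complex_vector \<Rightarrow> 'b::complex_vector \<Rightarrow> ('a, 'b) alg_tensor"
  is "\<lambda>x y. [(x, y)]" .

text \<open>The inner product of \<open>\<Sum> x\<^sub>i \<otimes> y\<^sub>i\<close> and \<open>\<Sum> z\<^sub>j \<otimes> u\<^sub>j\<close> is \<open>\<Sum> \<langle>x\<^sub>i, z\<^sub>j\<rangle> \<langle>y\<^sub>i, u\<^sub>j\<rangle>\<close>.\<close>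

definition list_cinner :: "('a::complex_inner \<times> 'b::complex_inner) list \<Rightarrow> ('a \<times> 'b) list \<Rightarrow> complex" where
  "list_cinner s t = (\<Sum>(x, y)\<leftarrow>s. \<Sum>(z, u)\<leftarrow>t. cinner x z * cinner y u)"

lemma list_cinner_alt:
  "list_cinner s t = sum_form (\<lambda>x y. sum_form (\<lambda>z u. cinner x z * cinner y u) t) s"
  by (simp add: list_cinner_def sum_form_def)

lemma list_cinner_commute: "list_cinner s t = cnj (list_cinner t s)"
proof (induction s)
  case Nil
  have "sum_form (\<lambda>x y. 0) t = 0" by (induction t) auto
  thus ?case by (simp add: list_cinner_alt)
next
  case (Cons p s)
  have "sum_form (\<lambda>z u. cinner (fst p) z * cinner (snd p) u) t =
      cnj (sum_form (\<lambda>z u. cinner z (fst p) * cinner u (snd p)) t)"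
    unfolding sum_form_cnj[symmetric]
    by (intro arg_cong2[of _ _ _ _ sum_form] ext refl)
      (simp add: cinner_commute[symmetric])
  thus ?case using Cons by (simp add: list_cinner_alt sum_form_add)
qed

lemma cbilinear_list_cinner:
  "cbilinear (\<lambda>x y. sum_form (\<lambda>z u. cinner x z * cinner y u) t)"
  unfolding cbilinear_def
  by (simp add: cinner_add_left cinner_scaleC_left algebra_simps flip: sum_form_add sum_form_mult)

lemma list_cinner_cong_left: "tensor_eq s s' \<Longrightarrow> list_cinner s t = list_cinner s' t"
  using cbilinear_list_cinner by (auto simp: list_cinner_alt tensor_eq_def)

subsection \<open>Positive definiteness\<close>

definition orthonormal :: "'a::complex_inner set \<Rightarrow> bool" where
  "orthonormal E \<longleftrightarrow> (\<forall>e\<in>E. \<forall>f\<in>E. cinner e f = (if e = f then 1 else 0))"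

lemma cinner_sum_left: "cinner (\<Sum>i\<in>I. f i) y = (\<Sum>i\<in>I. cinner (f i) y)"
  by (induction I rule: infinite_finite_induct) (simp_all add: cinner_add_left)

lemma orthonormal_expand:
  fixes Y :: "'a::complex_inner set"
  assumes "finite Y"
  shows "\<exists>E. finite E \<and> orthonormal E \<and> (\<forall>y\<in>Y. y = (\<Sum>e\<in>E. cinner y e *\<^sub>C e))"
  using assms
proof (induction Y)
  case empty
  show ?case by (rule exI[of _ "{}"]) (simp add: orthonormal_def)
next
  case (insert y Y)
  then obtain E where E: "finite E" "orthonormal E" "\<And>y. y \<in> Y \<Longrightarrow> y = (\<Sum>e\<in>E. cinner y e *\<^sub>C e)"
    by blast
  define r where "r = y - (\<Sum>e\<in>E. cinner y e *\<^sub>C e)"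
  have perp: "cinner r f = 0" if "f \<in> E" for f
  proof -
    have "(\<Sum>e\<in>E. cinner y e * cinner e f) = (\<Sum>e\<in>E. if e = f then cinner y e else 0)"
      using E(2) that by (intro sum.cong) (auto simp: orthonormal_def)
    also have "\<dots> = cinner y f" using E(1) that by simp
    finally show ?thesis
      by (simp add: r_def cinner_diff_left cinner_sum_left cinner_scaleC_left)
  qed
  show ?case
  proof (cases "r = 0")
    case True
    hence "y = (\<Sum>e\<in>E. cinner y e *\<^sub>C e)" by (simp add: r_def)
    thus ?thesis using E by (intro exI[of _ E]) blast
  next
    case False
    define g where "g = complex_of_real (inverse (norm r)) *\<^sub>C r"
    have rg: "r = complex_of_real (norm r) *\<^sub>C g"
      using False by (simp add: g_def scaleC_scaleC scaleC_one)
    have perp_g: "cinner g f = 0" "cinner f g = 0" if "f \<in> E" for f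
    proof -
      show "cinner g f = 0" using perp[OF that] by (simp add: g_def cinner_scaleC_left)
      thus "cinner f g = 0" using cinner_commute[of f g] by simp
    qed
    have gg: "cinner g g = 1"
      using False norm_sq_cinner[of g] by (simp add: g_def norm_scaleC norm_inverse)
    have gE: "g \<notin> E" using perp_g gg by fastforce
    have "orthonormal (insert g E)"
      using E(2) gg perp_g gE by (auto simp: orthonormal_def)
    moreover have "z = (\<Sum>e\<in>insert g E. cinner z e *\<^sub>C e)" if "z \<in> insert y Y" for z
    proof (cases "z \<in> Y")
      case True
      have "cinner z g = 0"
        by (subst E(3)[OF True]) (simp add: cinner_sum_left cinner_scaleC_left perp_g)
      thus ?thesis using E(1) gE E(3)[OF True] by simp
    next
      case False
      hence z: "z = y" using that by simp
      have yy: "y = r + (\<Sum>e\<in>E. cinner y e *\<^sub>C e)" by (simp add: r_def)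
      have "cinner y g = cinner r g"
        by (subst yy) (simp add: cinner_add_left cinner_sum_left cinner_scaleC_left perp_g)
      also have "\<dots> = complex_of_real (norm r)"
        by (subst rg) (simp add: cinner_scaleC_left gg)
      finally show ?thesis using E(1) gE rg yy unfolding z by simp
    qed
    ultimately show ?thesis using E(1) by (intro exI[of _ "insert g E"]) blast
  qed
qed

definition slice :: "('a::complex_vector \<times> 'b::complex_inner) list \<Rightarrow> 'b \<Rightarrow> 'a" where
  "slice s e = (\<Sum>(x, y)\<leftarrow>s. cinner y e *\<^sub>C x)"

lemma slice_simps [simp]:
  "slice [] e = 0" "slice (p # s) e = cinner (snd p) e *\<^sub>C fst p + slice s e"
  by (simp_all add: slice_def case_prod_beta)

lemma cbilinear_zero:
  assumes "cbilinear \<beta>"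
  shows "\<beta> 0 y = 0" "\<beta> x 0 = 0"
  using cbilinear_simps(1)[OF assms, of 0 0] cbilinear_simps(3)[OF assms, of x 0 0] by auto

lemma sum_form_slice:
  assumes \<beta>: "cbilinear \<beta>" and E: "\<forall>y\<in>snd ` set s. y = (\<Sum>e\<in>E. cinner y e *\<^sub>C e)"
  shows "sum_form \<beta> s = (\<Sum>e\<in>E. \<beta> (slice s e) e)"
  using E
proof (induction s)
  case Nil
  show ?case by (simp add: cbilinear_zero[OF \<beta>])
next
  case (Cons p s)
  have *: "\<beta> x (\<Sum>e\<in>F. c e *\<^sub>C e) = (\<Sum>e\<in>F. c e * \<beta> x e)" for x F c
    by (induction F rule: infinite_finite_induct)
      (simp_all add: cbilinear_zero[OF \<beta>] cbilinear_simps[OF \<beta>])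
  have "\<beta> (fst p) (snd p) = \<beta> (fst p) (\<Sum>e\<in>E. cinner (snd p) e *\<^sub>C e)"
    using Cons.prems by auto
  also have "\<dots> = (\<Sum>e\<in>E. cinner (snd p) e * \<beta> (fst p) e)" by (rule *)
  finally show ?case
    using Cons by (simp add: cbilinear_simps[OF \<beta>] sum.distrib)
qed

lemma cinner_slice: "sum_form (\<lambda>z u. cinner v z * cinner e u) s = cinner v (slice s e)"
proof (induction s)
  case (Cons p s)
  thus ?case
    using cinner_commute[of e "snd p"]
    by (simp add: cinner_add_right cinner_scaleC_right)
qed simp

lemma list_cinner_self:
  assumes E: "\<forall>y\<in>snd ` set s. y = (\<Sum>e\<in>E. cinner y e *\<^sub>C e)"
  shows "list_cinner s s = complex_of_real (\<Sum>e\<in>E. (norm (slice s e))\<^sup>2)"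
  using sum_form_slice[OF cbilinear_list_cinner[of s] E]
  by (simp add: list_cinner_alt cinner_slice norm_sq_cinner[symmetric])

lemma list_cinner_self_eq_0:
  assumes "list_cinner s s = 0"
  shows "tensor_eq s []"
proof -
  obtain E where E: "finite E" "\<forall>y\<in>snd ` set s. y = (\<Sum>e\<in>E. cinner y e *\<^sub>C e)"
    using orthonormal_expand[of "snd ` set s"] by auto
  have "(\<Sum>e\<in>E. (norm (slice s e))\<^sup>2) = 0"
    using assms list_cinner_self[OF E(2)] by (metis of_real_eq_0_iff)
  hence "slice s e = 0" if "e \<in> E" for e
    using that E(1) by (simp add: sum_nonneg_eq_0_iff)
  thus ?thesis
    using sum_form_slice[OF _ E(2)] by (simp add: tensor_eq_def cbilinear_zero)
qed

instantiation alg_tensor :: (complex_inner, complex_inner) cinner_vector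
begin

lift_definition cinner_alg_tensor :: "('a, 'b) alg_tensor \<Rightarrow> ('a, 'b) alg_tensor \<Rightarrow> complex"
  is list_cinner
  by (metis list_cinner_cong_left list_cinner_commute)

instance
proof
  fix s t u :: "('a, 'b) alg_tensor" and a :: complex
  show "cinner s t = cnj (cinner t s)" by transfer (rule list_cinner_commute)
  show "cinner (s + t) u = cinner s u + cinner t u" by transfer (simp add: list_cinner_alt)
  show "cinner (a *\<^sub>C s) t = a * cinner s t"
    by transfer (simp add: list_cinner_alt sum_form_scaleC[OF cbilinear_list_cinner])
  show "0 \<le> Re (cinner s s)"
  proof transfer
    fix s :: "('a \<times> 'b) list"
    obtain E where "finite E" "\<forall>y\<in>snd ` set s. y = (\<Sum>e\<in>E. cinner y e *\<^sub>C e)"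
      using orthonormal_expand[of "snd ` set s"] by auto
    thus "0 \<le> Re (list_cinner s s)"
      by (simp add: list_cinner_self sum_nonneg del: of_real_sum of_real_power)
  qed
  show "cinner s s = 0 \<longleftrightarrow> s = 0"
  proof transfer
    fix s :: "('a \<times> 'b) list"
    show "list_cinner s s = 0 \<longleftrightarrow> tensor_eq s []"
      using list_cinner_self_eq_0[of s] list_cinner_cong_left[of s "[]" s]
      by (auto simp: list_cinner_alt)
  qed
qed

end

instantiation alg_tensor :: (complex_inner, complex_inner) complex_inner
begin

definition norm_alg_tensor :: "('a, 'b) alg_tensor \<Rightarrow> real" where
  "norm_alg_tensor t = cinner_norm t"

definition dist_alg_tensor :: "('a, 'b) alg_tensor \<Rightarrow> ('a, 'b) alg_tensor \<Rightarrow> real" where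
  "dist_alg_tensor s t = norm (s - t)"

definition sgn_alg_tensor :: "('a, 'b) alg_tensor \<Rightarrow> ('a, 'b) alg_tensor" where
  "sgn_alg_tensor t = t /\<^sub>R norm t"

definition uniformity_alg_tensor :: "(('a, 'b) alg_tensor \<times> ('a, 'b) alg_tensor) filter" where
  "uniformity_alg_tensor = (INF e\<in>{0 <..}. principal {(x, y). dist x y < e})"

definition open_alg_tensor :: "('a, 'b) alg_tensor set \<Rightarrow> bool" where
  "open_alg_tensor U = (\<forall>x\<in>U. eventually (\<lambda>(x', y). x' = x \<longrightarrow> y \<in> U) uniformity)"

instance
proof
  fix s t u :: "('a, 'b) alg_tensor" and r :: real and U :: "('a, 'b) alg_tensor set"
  show "dist s t = norm (s - t)" by (rule dist_alg_tensor_def)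
  show "sgn s = s /\<^sub>R norm s" by (rule sgn_alg_tensor_def)
  show "uniformity = (INF e\<in>{0 <..}. principal {(x, y). dist x y < (e::real)} ::
      (('a, 'b) alg_tensor \<times> ('a, 'b) alg_tensor) filter)"
    by (rule uniformity_alg_tensor_def)
  show "open U = (\<forall>x\<in>U. eventually (\<lambda>(x', y). x' = x \<longrightarrow> y \<in> U) uniformity)"
    by (rule open_alg_tensor_def)
  show "norm s = sqrt (Re (cinner s s))" by (rule norm_alg_tensor_def[unfolded cinner_norm_def])
  show "norm s = 0 \<longleftrightarrow> s = 0" by (simp add: norm_alg_tensor_def cinner_norm_eq_0)
  show "norm (s + t) \<le> norm s + norm t" by (simp add: norm_alg_tensor_def cinner_norm_triangle)
  show "norm (r *\<^sub>R s) = \<bar>r\<bar> * norm s"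
    by (simp add: norm_alg_tensor_def scaleR_scaleC cinner_norm_scaleC)
qed

end


section \<open>Completion\<close>

definition cauchy_eq :: "(nat \<Rightarrow> 'a::complex_inner) \<Rightarrow> (nat \<Rightarrow> 'a) \<Rightarrow> bool" where
  "cauchy_eq X Y \<longleftrightarrow> Cauchy X \<and> Cauchy Y \<and> (\<lambda>n. X n - Y n) \<longlonglongrightarrow> 0"

quotient_type (overloaded) 'a hcompletion = "nat \<Rightarrow> 'a::complex_inner" / partial: cauchy_eq
proof (rule part_equivpI)
  have "cauchy_eq (\<lambda>n. 0 :: 'a) (\<lambda>n. 0)"
    by (simp add: cauchy_eq_def convergent_Cauchy convergent_const)
  thus "\<exists>X::nat \<Rightarrow> 'a. cauchy_eq X X" by blast
  show "symp (cauchy_eq :: (nat \<Rightarrow> 'a) \<Rightarrow> _)"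
  proof (rule sympI)
    fix X Y :: "nat \<Rightarrow> 'a"
    assume "cauchy_eq X Y"
    thus "cauchy_eq Y X"
      using tendsto_minus[of "\<lambda>n. X n - Y n" 0 sequentially] by (simp add: cauchy_eq_def)
  qed
  show "transp (cauchy_eq :: (nat \<Rightarrow> 'a) \<Rightarrow> _)"
  proof (rule transpI)
    fix X Y Z :: "nat \<Rightarrow> 'a"
    assume "cauchy_eq X Y" "cauchy_eq Y Z"
    thus "cauchy_eq X Z"
      using tendsto_add[of "\<lambda>n. X n - Y n" 0 sequentially "\<lambda>n. Y n - Z n" 0]
      by (simp add: cauchy_eq_def)
  qed
qed

lemma cauchy_eq_refl: "cauchy_eq X X \<longleftrightarrow> Cauchy X"
  by (simp add: cauchy_eq_def)

lemma cauchy_eq_Cauchy: "cauchy_eq X Y \<Longrightarrow> Cauchy X" "cauchy_eq X Y \<Longrightarrow> Cauchy Y"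
  by (simp_all add: cauchy_eq_def)

lemma hcompletion_cases:
  obtains X where "Cauchy X" "c = abs_hcompletion X"
  using Quotient3_abs_rep[OF Quotient3_hcompletion, of c]
    Quotient3_rep_reflp[OF Quotient3_hcompletion, of c] that
  by (metis cauchy_eq_refl)

lemma Cauchy_bounded_clinear:
  assumes "bounded_clinear f" "Cauchy X"
  shows "Cauchy (\<lambda>n. f (X n))"
  by (rule bounded_linear.Cauchy[OF bounded_clinear_bounded_linear[OF assms(1)] assms(2)])

lemma cauchy_eq_bounded_clinear:
  assumes f: "bounded_clinear f" and XY: "cauchy_eq X Y"
  shows "cauchy_eq (\<lambda>n. f (X n)) (\<lambda>n. f (Y n))"
proof -
  have "(\<lambda>n. f (X n - Y n)) \<longlonglongrightarrow> 0"
    by (rule bounded_linear.tendsto_zero[OF bounded_clinear_bounded_linear[OF f]])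
      (use XY in \<open>simp add: cauchy_eq_def\<close>)
  thus ?thesis
    using XY Cauchy_bounded_clinear[OF f] clinear_simps(4)[OF bounded_clinear_clinear[OF f]]
    by (simp add: cauchy_eq_def)
qed

lemma bounded_clinear_scaleC: "bounded_clinear (\<lambda>x. a *\<^sub>C x)"
  unfolding bounded_clinear_def clinear_def
  by (auto simp: scaleC_add_right scaleC_scaleC mult.commute norm_scaleC intro!: exI[of _ "cmod a"])

lemma Cauchy_plus:
  fixes X Y :: "nat \<Rightarrow> 'a::real_normed_vector"
  assumes "Cauchy X" "Cauchy Y"
  shows "Cauchy (\<lambda>n. X n + Y n)"
proof (rule metric_CauchyI)
  fix e :: real
  assume e: "0 < e"
  obtain M where M: "\<And>m n. m \<ge> M \<Longrightarrow> n \<ge> M \<Longrightarrow> dist (X m) (X n) < e / 2"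
    using metric_CauchyD[OF assms(1), of "e / 2"] e by auto
  obtain N where N: "\<And>m n. m \<ge> N \<Longrightarrow> n \<ge> N \<Longrightarrow> dist (Y m) (Y n) < e / 2"
    using metric_CauchyD[OF assms(2), of "e / 2"] e by auto
  have "dist (X m + Y m) (X n + Y n) < e" if "m \<ge> max M N" "n \<ge> max M N" for m n
  proof -
    have "dist (X m + Y m) (X n + Y n) \<le> dist (X m) (X n) + dist (Y m) (Y n)"
      by (rule dist_triangle_add)
    thus ?thesis using M[of m n] N[of m n] that by simp
  qed
  thus "\<exists>M. \<forall>m\<ge>M. \<forall>n\<ge>M. dist (X m + Y m) (X n + Y n) < e" by blast
qed

lemma cinner_null:
  fixes X Y :: "nat \<Rightarrow> 'a::complex_inner"
  assumes "X \<longlonglongrightarrow> 0" "Bseq Y"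
  shows "(\<lambda>n. cinner (X n) (Y n)) \<longlonglongrightarrow> 0" "(\<lambda>n. cinner (Y n) (X n)) \<longlonglongrightarrow> 0"
proof -
  obtain K where K: "\<And>n. norm (Y n) \<le> K"
    using assms(2) by (auto simp: Bseq_def)
  have "norm (cinner (X n) (Y n)) \<le> norm (X n) * K" for n
    using Cauchy_Schwarz_cinner[of "X n" "Y n"] mult_left_mono[OF K, of "norm (X n)"]
    by (meson norm_ge_zero order_trans)
  thus 1: "(\<lambda>n. cinner (X n) (Y n)) \<longlonglongrightarrow> 0"
    by (intro tendsto_0_le[OF assms(1), of _ K] always_eventually) simp
  show "(\<lambda>n. cinner (Y n) (X n)) \<longlonglongrightarrow> 0"
    using tendsto_cnj[OF 1] by (simp add: cinner_commute[symmetric])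
qed

lemma convergent_cinner:
  fixes X Y :: "nat \<Rightarrow> 'a::complex_inner"
  assumes X: "Cauchy X" and Y: "Cauchy Y"
  shows "convergent (\<lambda>n. cinner (X n) (Y n))"
proof -
  obtain K where K: "K > 0" "\<And>n. norm (X n) \<le> K"
    using Cauchy_Bseq[OF X] by (auto simp: Bseq_def)
  obtain L where L: "L > 0" "\<And>n. norm (Y n) \<le> L"
    using Cauchy_Bseq[OF Y] by (auto simp: Bseq_def)
  have "Cauchy (\<lambda>n. cinner (X n) (Y n))"
  proof (rule metric_CauchyI)
    fix e :: real
    assume e: "0 < e"
    define d where "d = e / (K + L)"
    have d: "d > 0" "d * L + K * d = e"
    proof -
      have "d * (K + L) = e" using K(1) L(1) by (simp add: d_def)
      thus "d * L + K * d = e" by (simp add: algebra_simps)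
    qed (use e K(1) L(1) in \<open>simp add: d_def\<close>)
    obtain M where M: "\<And>m n. m \<ge> M \<Longrightarrow> n \<ge> M \<Longrightarrow> dist (X m) (X n) < d"
      using metric_CauchyD[OF X d(1)] by auto
    obtain N where N: "\<And>m n. m \<ge> N \<Longrightarrow> n \<ge> N \<Longrightarrow> dist (Y m) (Y n) < d"
      using metric_CauchyD[OF Y d(1)] by auto
    have "dist (cinner (X m) (Y m)) (cinner (X n) (Y n)) < e"
      if "m \<ge> max M N" "n \<ge> max M N" for m n
    proof -
      have *: "cinner (X m) (Y m) - cinner (X n) (Y n) =
          cinner (X m - X n) (Y m) + cinner (X n) (Y m - Y n)"
        by (simp add: cinner_diff_left cinner_diff_right)
      have "dist (cinner (X m) (Y m)) (cinner (X n) (Y n)) \<le>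
          norm (X m - X n) * norm (Y m) + norm (X n) * norm (Y m - Y n)"
        unfolding dist_norm *
        by (intro norm_triangle_le add_mono Cauchy_Schwarz_cinner)
      also have "\<dots> \<le> norm (X m - X n) * L + K * norm (Y m - Y n)"
        by (intro add_mono mult_left_mono mult_right_mono K L) auto
      also have "\<dots> < d * L + K * d"
        using M[of m n] N[of m n] that K(1) L(1)
        by (intro add_strict_mono mult_strict_right_mono mult_strict_left_mono)
          (auto simp: dist_norm)
      finally show ?thesis using d(2) by simp
    qed
    thus "\<exists>M. \<forall>m\<ge>M. \<forall>n\<ge>M. dist (cinner (X m) (Y m)) (cinner (X n) (Y n)) < e" by blast
  qed
  thus ?thesis by (rule Cauchy_convergent)
qed

lemma lim_cinner_cong:
  assumes "cauchy_eq X X'" "cauchy_eq Y Y'"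
  shows "lim (\<lambda>n. cinner (X n) (Y n)) = lim (\<lambda>n. cinner (X' n) (Y' n))"
proof -
  have "(\<lambda>n. cinner (X n - X' n) (Y n) + cinner (X' n) (Y n - Y' n)) \<longlonglongrightarrow> 0 + 0"
    using assms by (intro tendsto_add cinner_null Cauchy_Bseq) (auto simp: cauchy_eq_def)
  hence 0: "(\<lambda>n. cinner (X n) (Y n) - cinner (X' n) (Y' n)) \<longlonglongrightarrow> 0"
    by (simp add: cinner_diff_left cinner_diff_right)
  have "(\<lambda>n. cinner (X' n) (Y' n)) \<longlonglongrightarrow> lim (\<lambda>n. cinner (X' n) (Y' n))"
    using convergent_cinner assms by (metis cauchy_eq_Cauchy(2) convergent_LIMSEQ_iff)
  from tendsto_add[OF 0 this] show ?thesis by (simp add: limI)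
qed

lemma tendsto_lim_cinner:
  fixes X Y :: "nat \<Rightarrow> 'a::complex_inner"
  shows "Cauchy X \<Longrightarrow> Cauchy Y \<Longrightarrow> (\<lambda>n. cinner (X n) (Y n)) \<longlonglongrightarrow> lim (\<lambda>n. cinner (X n) (Y n))"
  using convergent_cinner[of X Y] by (simp only: convergent_LIMSEQ_iff)

instantiation hcompletion :: (complex_inner) cinner_vector
begin

lift_definition zero_hcompletion :: "'a hcompletion" is "\<lambda>n. 0"
  by (simp add: cauchy_eq_def convergent_Cauchy convergent_const)

lift_definition plus_hcompletion :: "'a hcompletion \<Rightarrow> 'a hcompletion \<Rightarrow> 'a hcompletion"
  is "\<lambda>X Y n. X n + Y n"
proof -
  fix X X' Y Y' :: "nat \<Rightarrow> 'a"
  assume "cauchy_eq X X'" "cauchy_eq Y Y'"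
  thus "cauchy_eq (\<lambda>n. X n + Y n) (\<lambda>n. X' n + Y' n)"
    using tendsto_add[of "\<lambda>n. X n - X' n" 0 sequentially "\<lambda>n. Y n - Y' n" 0]
    by (auto simp: cauchy_eq_def Cauchy_plus algebra_simps)
qed

lift_definition scaleC_hcompletion :: "complex \<Rightarrow> 'a hcompletion \<Rightarrow> 'a hcompletion"
  is "\<lambda>a X n. a *\<^sub>C X n"
  by (rule cauchy_eq_bounded_clinear[OF bounded_clinear_scaleC])

lift_definition cinner_hcompletion :: "'a hcompletion \<Rightarrow> 'a hcompletion \<Rightarrow> complex"
  is "\<lambda>X Y. lim (\<lambda>n. cinner (X n) (Y n))"
  by (rule lim_cinner_cong)

definition scaleR_hcompletion :: "real \<Rightarrow> 'a hcompletion \<Rightarrow> 'a hcompletion" where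
  "scaleR_hcompletion r = scaleC (complex_of_real r)"

definition uminus_hcompletion :: "'a hcompletion \<Rightarrow> 'a hcompletion" where
  "uminus_hcompletion c = (- 1) *\<^sub>C c"

definition minus_hcompletion :: "'a hcompletion \<Rightarrow> 'a hcompletion \<Rightarrow> 'a hcompletion" where
  "minus_hcompletion c d = c + (- 1) *\<^sub>C d"

lemma cauchy_eq_eqI: "cauchy_eq X X \<Longrightarrow> X = Y \<Longrightarrow> cauchy_eq X Y"
  by simp

instance
proof
  fix s t u :: "'a hcompletion" and a b :: complex and r :: real
  note C = cauchy_eq_refl Cauchy_plus Cauchy_bounded_clinear[OF bounded_clinear_scaleC]
    convergent_Cauchy convergent_const
  show "s + t + u = s + (t + u)"
    by transfer (rule cauchy_eq_eqI, simp_all add: C add.assoc)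
  show "s + t = t + s"
    by transfer (rule cauchy_eq_eqI, simp_all add: C add.commute)
  show "0 + s = s"
    by transfer (rule cauchy_eq_eqI, simp_all add: C)
  show "- s + s = 0" unfolding uminus_hcompletion_def
    by transfer (rule cauchy_eq_eqI, simp_all add: C scaleC_minus_one)
  show "s - t = s + - t" by (simp add: uminus_hcompletion_def minus_hcompletion_def)
  show "scaleR r = (scaleC (complex_of_real r) :: 'a hcompletion \<Rightarrow> _)"
    by (rule scaleR_hcompletion_def)
  show "a *\<^sub>C (s + t) = a *\<^sub>C s + a *\<^sub>C t"
    by transfer (rule cauchy_eq_eqI, simp_all add: C scaleC_add_right)
  show "(a + b) *\<^sub>C s = a *\<^sub>C s + b *\<^sub>C s"
    by transfer (rule cauchy_eq_eqI, simp_all add: C scaleC_add_left)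
  show "a *\<^sub>C b *\<^sub>C s = (a * b) *\<^sub>C s"
    by transfer (rule cauchy_eq_eqI, simp_all add: C scaleC_scaleC)
  show "1 *\<^sub>C s = s"
    by transfer (rule cauchy_eq_eqI, simp_all add: C scaleC_one)
  show "cinner s t = cnj (cinner t s)"
  proof (transfer, unfold cauchy_eq_refl)
    fix X Y :: "nat \<Rightarrow> 'a"
    assume "Cauchy X" "Cauchy Y"
    from tendsto_cnj[OF tendsto_lim_cinner[OF this(2,1)]]
    show "lim (\<lambda>n. cinner (X n) (Y n)) = cnj (lim (\<lambda>n. cinner (Y n) (X n)))"
      by (simp add: limI cinner_commute[symmetric])
  qed
  show "cinner (s + t) u = cinner s u + cinner t u"
  proof (transfer, unfold cauchy_eq_refl)
    fix X Y Z :: "nat \<Rightarrow> 'a"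
    assume "Cauchy X" "Cauchy Y" "Cauchy Z"
    thus "lim (\<lambda>n. cinner (X n + Y n) (Z n)) =
        lim (\<lambda>n. cinner (X n) (Z n)) + lim (\<lambda>n. cinner (Y n) (Z n))"
      by (intro limI) (simp add: cinner_add_left tendsto_add tendsto_lim_cinner)
  qed
  show "cinner (a *\<^sub>C s) t = a * cinner s t"
  proof (transfer, unfold cauchy_eq_refl)
    fix X Y :: "nat \<Rightarrow> 'a" and a :: complex
    assume "Cauchy X" "Cauchy Y"
    thus "lim (\<lambda>n. cinner (a *\<^sub>C X n) (Y n)) = a * lim (\<lambda>n. cinner (X n) (Y n))"
      by (intro limI) (simp add: cinner_scaleC_left tendsto_mult_left tendsto_lim_cinner)
  qed
  show "0 \<le> Re (cinner s s)"
  proof (transfer, unfold cauchy_eq_refl)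
    fix X :: "nat \<Rightarrow> 'a"
    assume X: "Cauchy X"
    show "0 \<le> Re (lim (\<lambda>n. cinner (X n) (X n)))"
      by (rule tendsto_lowerbound[OF tendsto_Re[OF tendsto_lim_cinner[OF X X]]])
        (simp_all add: cinner_self_ge_zero)
  qed
  show "cinner s s = 0 \<longleftrightarrow> s = 0"
  proof (transfer, unfold cauchy_eq_refl)
    fix X :: "nat \<Rightarrow> 'a"
    assume X: "Cauchy X"
    show "lim (\<lambda>n. cinner (X n) (X n)) = 0 \<longleftrightarrow> cauchy_eq X (\<lambda>n. 0)"
    proof
      assume "lim (\<lambda>n. cinner (X n) (X n)) = 0"
      with tendsto_lim_cinner[OF X X] have "(\<lambda>n. sqrt (Re (cinner (X n) (X n)))) \<longlonglongrightarrow> sqrt (Re 0)"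
        by (intro tendsto_real_sqrt tendsto_Re) simp
      hence "(\<lambda>n. norm (X n)) \<longlonglongrightarrow> 0"
        by (simp add: norm_eq_sqrt_cinner)
      thus "cauchy_eq X (\<lambda>n. 0)"
        using X by (simp add: cauchy_eq_def tendsto_norm_zero_iff convergent_Cauchy convergent_const)
    next
      assume "cauchy_eq X (\<lambda>n. 0)"
      from lim_cinner_cong[OF this this] show "lim (\<lambda>n. cinner (X n) (X n)) = 0"
        by simp
    qed
  qed
qed

end

instantiation hcompletion :: (complex_inner) complex_inner
begin

definition norm_hcompletion :: "'a hcompletion \<Rightarrow> real" where
  "norm_hcompletion t = cinner_norm t"

definition dist_hcompletion :: "'a hcompletion \<Rightarrow> 'a hcompletion \<Rightarrow> real" where
  "dist_hcompletion s t = norm (s - t)"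

definition sgn_hcompletion :: "'a hcompletion \<Rightarrow> 'a hcompletion" where
  "sgn_hcompletion t = t /\<^sub>R norm t"

definition uniformity_hcompletion :: "('a hcompletion \<times> 'a hcompletion) filter" where
  "uniformity_hcompletion = (INF e\<in>{0 <..}. principal {(x, y). dist x y < e})"

definition open_hcompletion :: "'a hcompletion set \<Rightarrow> bool" where
  "open_hcompletion U = (\<forall>x\<in>U. eventually (\<lambda>(x', y). x' = x \<longrightarrow> y \<in> U) uniformity)"

instance
proof
  fix s t u :: "'a hcompletion" and r :: real and U :: "'a hcompletion set"
  show "dist s t = norm (s - t)" by (rule dist_hcompletion_def)
  show "sgn s = s /\<^sub>R norm s" by (rule sgn_hcompletion_def)
  show "uniformity = (INF e\<in>{0 <..}. principal {(x, y). dist x y < (e::real)} ::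
      ('a hcompletion \<times> 'a hcompletion) filter)"
    by (rule uniformity_hcompletion_def)
  show "open U = (\<forall>x\<in>U. eventually (\<lambda>(x', y). x' = x \<longrightarrow> y \<in> U) uniformity)"
    by (rule open_hcompletion_def)
  show "norm s = sqrt (Re (cinner s s))" by (rule norm_hcompletion_def[unfolded cinner_norm_def])
  show "norm s = 0 \<longleftrightarrow> s = 0" by (simp add: norm_hcompletion_def cinner_norm_eq_0)
  show "norm (s + t) \<le> norm s + norm t" by (simp add: norm_hcompletion_def cinner_norm_triangle)
  show "norm (r *\<^sub>R s) = \<bar>r\<bar> * norm s"
    by (simp add: norm_hcompletion_def scaleR_scaleC cinner_norm_scaleC)
qed

end

lift_definition to_completion :: "'a::complex_inner \<Rightarrow> 'a hcompletion" is "\<lambda>x n. x"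
  by (simp add: cauchy_eq_def convergent_Cauchy convergent_const)

lemma cinner_to_completion: "cinner (to_completion x) (to_completion y) = cinner x y"
  by transfer simp

lemma norm_to_completion: "norm (to_completion x) = norm x"
  by (simp add: norm_eq_sqrt_cinner cinner_to_completion)

lemma clinear_to_completion: "clinear to_completion"
  unfolding clinear_def
  by (intro conjI allI; transfer) (simp_all add: cauchy_eq_def convergent_Cauchy convergent_const)

lemma norm_abs_hcompletion:
  assumes "Cauchy X"
  shows "(\<lambda>n. norm (X n)) \<longlonglongrightarrow> norm (abs_hcompletion X)"
  using tendsto_real_sqrt[OF tendsto_Re[OF tendsto_lim_cinner[OF assms assms]]] assms
  by (simp add: norm_eq_sqrt_cinner cinner_hcompletion.abs_eq cauchy_eq_refl)

lemma norm_abs_minus_to_completion: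
  assumes X: "Cauchy X"
  shows "(\<lambda>n. norm (X n - x)) \<longlonglongrightarrow> norm (abs_hcompletion X - to_completion x)"
proof -
  have C: "Cauchy (\<lambda>n. - x)"
    by (simp add: convergent_Cauchy convergent_const)
  have "abs_hcompletion X - to_completion x = abs_hcompletion X + to_completion (- x)"
    using clinear_simps(4)[OF clinear_to_completion, of 0 x] clinear_simps(3)[OF clinear_to_completion] by simp
  also have "\<dots> = abs_hcompletion (\<lambda>n. X n + - x)"
    using X C by (simp add: to_completion.abs_eq plus_hcompletion.abs_eq cauchy_eq_refl)
  finally show ?thesis
    using norm_abs_hcompletion[OF Cauchy_plus[OF X C]] by simp
qed

lemma to_completion_tendsto:
  assumes X: "Cauchy X"
  shows "(\<lambda>n. to_completion (X n)) \<longlonglongrightarrow> abs_hcompletion X"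
proof (rule metric_LIMSEQ_I)
  fix e :: real
  assume e: "0 < e"
  obtain N where N: "\<And>m n. m \<ge> N \<Longrightarrow> n \<ge> N \<Longrightarrow> dist (X m) (X n) < e / 2"
    using metric_CauchyD[OF X, of "e / 2"] e by auto
  have "dist (to_completion (X n)) (abs_hcompletion X) < e" if "n \<ge> N" for n
  proof -
    have "norm (abs_hcompletion X - to_completion (X n)) \<le> e / 2"
    proof (rule LIMSEQ_le_const2[OF norm_abs_minus_to_completion[OF X]], intro exI allI impI)
      fix m assume "N \<le> m"
      from N[OF this that] show "norm (X m - X n) \<le> e / 2" by (simp add: dist_norm)
    qed
    thus ?thesis using e by (simp add: dist_norm norm_minus_commute)
  qed
  thus "\<exists>N. \<forall>n\<ge>N. dist (to_completion (X n)) (abs_hcompletion X) < e" by blast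
qed

lemma to_completion_dense: "closure (range to_completion) = UNIV"
proof -
  have "c \<in> closure (range to_completion)" for c :: "'a hcompletion"
  proof -
    obtain X where "Cauchy X" "c = abs_hcompletion X" by (rule hcompletion_cases)
    thus ?thesis
      unfolding closure_sequential using to_completion_tendsto[of X]
      by (intro exI[of _ "\<lambda>n. to_completion (X n)"]) auto
  qed
  thus ?thesis by blast
qed

instance hcompletion :: (complex_inner) chilbert_space
proof
  fix F :: "nat \<Rightarrow> 'a hcompletion"
  assume F: "Cauchy F"
  have "\<exists>x. dist (F n) (to_completion x) < inverse (real (Suc n))" for n
  proof -
    have "F n \<in> closure (range to_completion)" by (simp add: to_completion_dense)
    moreover have "0 < inverse (real (Suc n))" by simp
    ultimately show ?thesis
      unfolding closure_approachable by (metis (no_types, lifting) dist_commute imageE)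
  qed
  then obtain x where x: "\<And>n. dist (F n) (to_completion (x n)) < inverse (real (Suc n))"
    by metis
  have "(\<lambda>n. inverse (real (Suc n))) \<longlonglongrightarrow> 0" by (rule LIMSEQ_inverse_real_of_nat)
  hence 0: "(\<lambda>n. to_completion (x n) - F n) \<longlonglongrightarrow> 0"
    by (rule Lim_null_comparison[rotated])
      (use x in \<open>auto intro!: always_eventually less_imp_le simp: dist_norm norm_minus_commute\<close>)
  have "Cauchy (\<lambda>n. F n + (to_completion (x n) - F n))"
    by (intro Cauchy_plus F convergent_Cauchy convergentI[OF 0])
  hence "Cauchy (\<lambda>n. to_completion (x n))" by simp
  moreover have "dist (to_completion (x m)) (to_completion (x n)) = dist (x m) (x n)" for m n
    unfolding dist_norm clinear_simps(4)[OF clinear_to_completion, symmetric] by (rule norm_to_completion)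
  ultimately have "Cauchy x" by (simp add: Cauchy_def)
  from tendsto_diff[OF to_completion_tendsto[OF this] 0] show "convergent F"
    by (auto intro: convergentI)
qed

lemma bounded_clinear_extension:
  fixes f :: "'a::complex_inner \<Rightarrow> 'b::complex_inner"
  assumes f: "bounded_clinear f"
  shows "\<exists>g. bounded_clinear g \<and> (\<forall>x. g (to_completion x) = to_completion (f x))"
proof -
  note lin = clinear_simps[OF bounded_clinear_clinear[OF f]]
  define g where "g c = abs_hcompletion (\<lambda>n. f (rep_hcompletion c n))" for c
  have g: "g (abs_hcompletion X) = abs_hcompletion (\<lambda>n. f (X n))" if "Cauchy X" for X
  proof -
    have "cauchy_eq (rep_hcompletion (abs_hcompletion X)) X"
      using Quotient3_rep_abs[OF Quotient3_hcompletion, of X] that by (simp add: cauchy_eq_refl)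
    from cauchy_eq_bounded_clinear[OF f this] show ?thesis
      unfolding g_def by (rule Quotient3_rel_abs[OF Quotient3_hcompletion])
  qed
  obtain M where M: "\<And>x. norm (f x) \<le> M * norm x"
    using f by (auto simp: bounded_clinear_def)
  have "g (c + d) = g c + g d" for c d
  proof -
    obtain X where X: "Cauchy X" "c = abs_hcompletion X" by (rule hcompletion_cases)
    obtain Y where Y: "Cauchy Y" "d = abs_hcompletion Y" by (rule hcompletion_cases)
    show ?thesis
      using X Y Cauchy_bounded_clinear[OF f]
      by (simp add: plus_hcompletion.abs_eq cauchy_eq_refl g Cauchy_plus lin)
  qed
  moreover have "g (a *\<^sub>C c) = a *\<^sub>C g c" for a c
  proof -
    obtain X where X: "Cauchy X" "c = abs_hcompletion X" by (rule hcompletion_cases)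
    show ?thesis
      using X Cauchy_bounded_clinear[OF f X(1)]
        g[OF Cauchy_bounded_clinear[OF bounded_clinear_scaleC X(1), of a]]
      by (simp add: scaleC_hcompletion.abs_eq cauchy_eq_refl g lin)
  qed
  moreover have "norm (g c) \<le> M * norm c" for c
  proof -
    obtain X where X: "Cauchy X" "c = abs_hcompletion X" by (rule hcompletion_cases)
    have "norm (abs_hcompletion (\<lambda>n. f (X n))) \<le> M * norm (abs_hcompletion X)"
      by (rule LIMSEQ_le[OF norm_abs_hcompletion[OF Cauchy_bounded_clinear[OF f X(1)]]
            tendsto_mult_left[OF norm_abs_hcompletion[OF X(1)]]]) (use M in blast)
    thus ?thesis using X by (simp add: g)
  qed
  moreover have "g (to_completion x) = to_completion (f x)" for x
    by (simp add: to_completion.abs_eq g convergent_Cauchy convergent_const)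
  ultimately show ?thesis
    unfolding bounded_clinear_def clinear_def by blast
qed


section \<open>The Hilbert space tensor product\<close>

type_synonym ('a, 'b) htensor = "('a, 'b) alg_tensor hcompletion"

definition elem_tensor :: "'a::complex_inner \<Rightarrow> 'b::complex_inner \<Rightarrow> ('a, 'b) htensor"
    (infixr "\<otimes>\<^sub>h" 70) where
  "x \<otimes>\<^sub>h y = to_completion (alg_elem_tensor x y)"

lemma cinner_elem_tensor: "cinner (x \<otimes>\<^sub>h y) (z \<otimes>\<^sub>h u) = cinner x z * cinner y u"
  unfolding elem_tensor_def cinner_to_completion
  by transfer (simp add: list_cinner_def)

lemma clinear_elem_tensor:
  fixes x :: "'a::complex_inner" and y :: "'b::complex_inner"
  shows "clinear (\<lambda>x :: 'a. x \<otimes>\<^sub>h y)" "clinear (\<lambda>y :: 'b. x \<otimes>\<^sub>h y)"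
proof -
  have bil: "alg_elem_tensor (x + x') y = alg_elem_tensor x y + alg_elem_tensor x' y"
    "alg_elem_tensor x (y + y') = alg_elem_tensor x y + alg_elem_tensor x y'"
    "alg_elem_tensor (c *\<^sub>C x) y = c *\<^sub>C alg_elem_tensor x y"
    "alg_elem_tensor x (c *\<^sub>C y) = c *\<^sub>C alg_elem_tensor x y"
    for x x' :: 'a and y y' :: 'b and c
    by (transfer, simp add: tensor_eq_def cbilinear_simps)+
  show "clinear (\<lambda>x :: 'a. x \<otimes>\<^sub>h y)" "clinear (\<lambda>y :: 'b. x \<otimes>\<^sub>h y)"
    by (simp_all add: bil clinear_def elem_tensor_def clinear_simps[OF clinear_to_completion])
qed

text \<open>\<open>tensor_op_ex1\<close> below shows that this is well defined for bounded \<open>A\<close> and \<open>B\<close>.\<close>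

definition tensor_op :: "('a::chilbert_space \<Rightarrow> 'a) \<Rightarrow> ('b::chilbert_space \<Rightarrow> 'b) \<Rightarrow>
    ('a, 'b) htensor \<Rightarrow> ('a, 'b) htensor" where
  "tensor_op A B = (THE C. bounded_clinear C \<and> (\<forall>x y. C (x \<otimes>\<^sub>h y) = A x \<otimes>\<^sub>h B y))"

lemma alg_tensor_induct:
  assumes "P 0" "\<And>x y t. P t \<Longrightarrow> P (alg_elem_tensor x y + t)"
  shows "P t"
proof -
  have "P (abs_alg_tensor s)" for s
  proof (induction s)
    case Nil
    show ?case using assms(1) by (simp add: zero_alg_tensor_def)
  next
    case (Cons p s)
    from assms(2)[OF this, of "fst p" "snd p"] show ?case
      by (simp add: alg_elem_tensor.abs_eq plus_alg_tensor.abs_eq)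
  qed
  thus ?thesis using Quotient3_abs_rep[OF Quotient3_alg_tensor] by metis
qed

lemma slice_map:
  assumes "clinear A"
  shows "slice (map (\<lambda>(x, y). (A x, y)) s) e = A (slice s e)"
  by (induction s) (auto simp: clinear_simps[OF assms])

lemma list_cinner_map_left:
  assumes "clinear A" "\<And>x. norm (A x) \<le> M * norm x"
  shows "Re (list_cinner (map (\<lambda>(x, y). (A x, y)) s) (map (\<lambda>(x, y). (A x, y)) s)) \<le>
    M\<^sup>2 * Re (list_cinner s s)"
proof -
  obtain E where E: "\<forall>y\<in>snd ` set s. y = (\<Sum>e\<in>E. cinner y e *\<^sub>C e)"
    using orthonormal_expand[of "snd ` set s"] by auto
  hence E': "\<forall>y\<in>snd ` set (map (\<lambda>(x, y). (A x, y)) s). y = (\<Sum>e\<in>E. cinner y e *\<^sub>C e)"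
    by force
  have "(\<Sum>e\<in>E. (norm (A (slice s e)))\<^sup>2) \<le> (\<Sum>e\<in>E. M\<^sup>2 * (norm (slice s e))\<^sup>2)"
    unfolding power_mult_distrib[symmetric]
    by (intro sum_mono power_mono assms(2)) auto
  thus ?thesis
    unfolding list_cinner_self[OF E] list_cinner_self[OF E'] Re_complex_of_real
    by (simp add: slice_map[OF assms(1)] sum_distrib_left)
qed

lemma list_cinner_swap: "list_cinner (map prod.swap s) (map prod.swap t) = list_cinner s t"
proof -
  have *: "sum_form \<beta> (map prod.swap s) = sum_form (\<lambda>x y. \<beta> y x) s"
    for \<beta> :: "'c \<Rightarrow> 'd \<Rightarrow> complex" and s
    by (induction s) auto
  show ?thesis by (simp add: list_cinner_alt * mult.commute)
qed

lemma list_cinner_map_right: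
  assumes "clinear B" "\<And>y. norm (B y) \<le> N * norm y"
  shows "Re (list_cinner (map (\<lambda>(x, y). (x, B y)) s) (map (\<lambda>(x, y). (x, B y)) s)) \<le>
    N\<^sup>2 * Re (list_cinner s s)"
proof -
  have "map (\<lambda>(x, y). (x, B y)) s = map prod.swap (map (\<lambda>(y, x). (B y, x)) (map prod.swap s))"
    by (induction s) auto
  thus ?thesis
    using list_cinner_map_left[OF assms, of "map prod.swap s"] by (simp only: list_cinner_swap)
qed

lemma alg_tensor_op_exists:
  fixes A :: "'a::complex_inner \<Rightarrow> 'a" and B :: "'b::complex_inner \<Rightarrow> 'b"
  assumes A: "bounded_clinear A" and B: "bounded_clinear B"
  shows "\<exists>F. bounded_clinear F \<and> (\<forall>x y. F (alg_elem_tensor x y) = alg_elem_tensor (A x) (B y))"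
proof -
  note linA = clinear_simps[OF bounded_clinear_clinear[OF A]]
  note linB = clinear_simps[OF bounded_clinear_clinear[OF B]]
  define h where "h = map (\<lambda>(x, y). (A x, B y))"
  define F where "F t = abs_alg_tensor (h (rep_alg_tensor t))" for t
  have h: "tensor_eq (h s) (h t)" if "tensor_eq s t" for s t
    unfolding tensor_eq_def
  proof (intro allI impI)
    fix \<beta> :: "'a \<Rightarrow> 'b \<Rightarrow> complex"
    assume "cbilinear \<beta>"
    hence "cbilinear (\<lambda>x y. \<beta> (A x) (B y))"
      by (simp add: cbilinear_def linA linB)
    thus "sum_form \<beta> (h s) = sum_form \<beta> (h t)"
      using that by (simp add: h_def sum_form_map tensor_eq_def)
  qed
  have F: "F (abs_alg_tensor s) = abs_alg_tensor (h s)" for s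
    unfolding F_def using h Quotient3_rep_abs[OF Quotient3_alg_tensor, of s]
    by (metis Quotient3_rel_abs[OF Quotient3_alg_tensor] tensor_eq_def)
  have ex: "\<exists>s. t = abs_alg_tensor s" for t :: "('a, 'b) alg_tensor"
    using Quotient3_abs_rep[OF Quotient3_alg_tensor, of t] by metis
  obtain M where M: "\<And>x. norm (A x) \<le> M * norm x"
    using A by (auto simp: bounded_clinear_def)
  obtain N where N: "\<And>x. norm (B x) \<le> N * norm x"
    using B by (auto simp: bounded_clinear_def)
  have "F (s + t) = F s + F t" for s t
    using ex[of s] ex[of t] by (auto simp: plus_alg_tensor.abs_eq F h_def)
  moreover have "F (a *\<^sub>C t) = a *\<^sub>C F t" for a t
    using ex[of t] by (auto simp: scaleC_alg_tensor.abs_eq F h_def linA intro!: arg_cong[of _ _ abs_alg_tensor])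
  moreover have "norm (F t) \<le> \<bar>M * N\<bar> * norm t" for t
  proof -
    obtain s where t: "t = abs_alg_tensor s" using ex by blast
    have "h s = map (\<lambda>(x, y). (A x, y)) (map (\<lambda>(x, y). (x, B y)) s)"
      by (simp add: h_def case_prod_beta)
    hence "Re (list_cinner (h s) (h s)) \<le> M\<^sup>2 * (N\<^sup>2 * Re (list_cinner s s))"
      using list_cinner_map_left[OF bounded_clinear_clinear[OF A] M, of "map (\<lambda>(x, y). (x, B y)) s"]
        mult_left_mono[OF list_cinner_map_right[OF bounded_clinear_clinear[OF B] N, of s], of "M\<^sup>2"]
      by simp
    hence "sqrt (Re (list_cinner (h s) (h s))) \<le> sqrt (M\<^sup>2 * (N\<^sup>2 * Re (list_cinner s s)))"
      by simp
    thus ?thesis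
      by (simp add: t F norm_eq_sqrt_cinner cinner_alg_tensor.abs_eq real_sqrt_mult abs_mult)
  qed
  moreover have "F (alg_elem_tensor x y) = alg_elem_tensor (A x) (B y)" for x y
    by (simp add: alg_elem_tensor.abs_eq F h_def)
  ultimately show ?thesis
    unfolding bounded_clinear_def clinear_def by blast
qed

lemma htensor_op_eqI:
  assumes C: "bounded_clinear C" and D: "bounded_clinear D"
    and eq: "\<And>x y. C (x \<otimes>\<^sub>h y) = D (x \<otimes>\<^sub>h y)"
  shows "C = D"
proof -
  note linC = clinear_simps[OF bounded_clinear_clinear[OF C]]
  note linD = clinear_simps[OF bounded_clinear_clinear[OF D]]
  have *: "C (to_completion t) = D (to_completion t)" for t
  proof (induction t rule: alg_tensor_induct)
    case 1
    show ?case by (simp add: clinear_simps[OF clinear_to_completion] linC linD)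
  next
    case (2 x y t)
    thus ?case
      using eq[of x y] by (simp add: clinear_simps[OF clinear_to_completion] linC linD elem_tensor_def)
  qed
  have "C c = D c" for c
  proof -
    obtain X where X: "Cauchy X" "c = abs_hcompletion X" by (rule hcompletion_cases)
    note lim = to_completion_tendsto[OF X(1), folded X(2)]
    have "(\<lambda>n. C (to_completion (X n))) \<longlonglongrightarrow> C c"
      by (rule bounded_linear.tendsto[OF bounded_clinear_bounded_linear[OF C] lim])
    moreover have "(\<lambda>n. C (to_completion (X n))) \<longlonglongrightarrow> D c"
      unfolding * by (rule bounded_linear.tendsto[OF bounded_clinear_bounded_linear[OF D] lim])
    ultimately show ?thesis by (rule LIMSEQ_unique)
  qed
  thus ?thesis by blast
qed

lemma tensor_op_ex1:
  fixes A :: "'a::complex_inner \<Rightarrow> 'a" and B :: "'b::complex_inner \<Rightarrow> 'b"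
  assumes "bounded_clinear A" "bounded_clinear B"
  shows "\<exists>!C. bounded_clinear C \<and> (\<forall>x y. C (x \<otimes>\<^sub>h y) = A x \<otimes>\<^sub>h B y)"
proof -
  obtain F where F: "bounded_clinear F"
    "\<And>x y. F (alg_elem_tensor x y) = alg_elem_tensor (A x) (B y)"
    using alg_tensor_op_exists[OF assms] by blast
  obtain C where C: "bounded_clinear C" "\<And>t. C (to_completion t) = to_completion (F t)"
    using bounded_clinear_extension[OF F(1)] by blast
  show ?thesis
  proof (rule ex1I[of _ C])
    show "bounded_clinear C \<and> (\<forall>x y. C (x \<otimes>\<^sub>h y) = A x \<otimes>\<^sub>h B y)"
      using C F(2) by (simp add: elem_tensor_def)
  next
    fix D
    assume "bounded_clinear D \<and> (\<forall>x y. D (x \<otimes>\<^sub>h y) = A x \<otimes>\<^sub>h B y)"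
    thus "D = C" using C F(2) by (intro htensor_op_eqI) (simp_all add: elem_tensor_def)
  qed
qed

lemma tensor_op:
  assumes "bounded_clinear A" "bounded_clinear B"
  shows "bounded_clinear (tensor_op A B)" "tensor_op A B (x \<otimes>\<^sub>h y) = A x \<otimes>\<^sub>h B y"
  using theI'[OF tensor_op_ex1[OF assms]] unfolding tensor_op_def by blast+


section \<open>Numerical radius\<close>

text \<open>
  All values are nonnegative, so inserting 0 changes the supremum only when there are no unit
  vectors: on the zero space the numerical radius is 0.
\<close>

definition numerical_radius :: "('a::chilbert_space \<Rightarrow> 'a) \<Rightarrow> real" where
  "numerical_radius T = Sup (insert 0 {cmod (cinner (T x) x) | x. norm x = 1})"

definition numerical_radius_dist :: "('a::chilbert_space \<Rightarrow> 'a) \<Rightarrow> real" where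
  "numerical_radius_dist T = (INF c. numerical_radius (\<lambda>x. T x - c *\<^sub>C x))"

end

theory Submission
  imports Defs
begin

text \<open>
  The theorem combines two inequalities for bounded operators: \<open>w(A \<otimes> B) \<le> w(A) \<parallel>B\<parallel>\<close> and
  \<open>\<parallel>B\<parallel> \<le> w(B) + d(B)\<close>. Exchanging the roles of \<open>A\<close> and \<open>B\<close> gives the other term of the minimum,
  and the last inequality holds because \<open>d(B) \<le> w(B)\<close>.

  The bound on the norm (\<open>norm_le_numerical_radius_add_dist\<close>) is polarization. For unit vectors \<open>x\<close>
  and \<open>y\<close>, chosen by a phase so that \<open>\<langle>x, y\<rangle>\<close> is real, \<open>4\<langle>Bx, y\<rangle>\<close> is the difference of the
  quadratic form of \<open>B\<close> at \<open>x \<plusminus> y\<close> plus \<open>\<i>\<close> times its difference at \<open>x \<plusminus> \<i>y\<close>. Since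
  \<open>x + \<i>y\<close> and \<open>x - \<i>y\<close> have equal norms, the second difference does not change when \<open>B\<close> is
  replaced by \<open>B - c\<close>. So the two parts are at most \<open>4w(B)\<close> and \<open>4w(B - c)\<close>.

  For the bound on the tensor product, a vector \<open>v = \<Sum> x\<^sub>i \<otimes> y\<^sub>i\<close> of the algebraic tensor product
  satisfies \<open>\<langle>(A \<otimes> B)v, v\<rangle> = \<Sum>\<^sub>i\<^sub>j \<langle>Ax\<^sub>i, x\<^sub>j\<rangle> \<langle>By\<^sub>i, y\<^sub>j\<rangle>\<close>, so everything happens in finite double
  sums. If \<open>\<phi>\<close> is a positive semidefinite form, then
  \<open>\<bar>\<Sum>\<^sub>i\<^sub>j \<langle>Ax\<^sub>i, x\<^sub>j\<rangle> \<phi>(y\<^sub>i, y\<^sub>j)\<bar> \<le> w(A) \<Sum>\<^sub>i\<^sub>j \<langle>x\<^sub>i, x\<^sub>j\<rangle> \<phi>(y\<^sub>i, y\<^sub>j)\<close>, because \<open>\<phi>\<close> is a sum of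
  rank one forms on the span of the \<open>y\<^sub>i\<close> (\<open>psd_form_tensor_bound\<close>). This is applied to the defect
  form \<open>\<phi>(u, v) = \<langle>u, v\<rangle> - \<langle>Bu, Bv\<rangle>\<close> of a strict contraction \<open>B\<close>, at the vectors
  \<open>\<Sum>\<^sub>k \<omega>\<^sup>k B\<^sup>k y\<^sub>i\<close> for all roots of unity \<open>\<omega>\<close> of a high order. Averaging over \<open>\<omega>\<close> selects the terms
  \<open>\<phi>(B\<^sup>k y\<^sub>i, B\<^sup>k y\<^sub>j)\<close>, whose sum over \<open>k\<close> telescopes to \<open>\<langle>y\<^sub>i, y\<^sub>j\<rangle>\<close>; averaging with the extra factor
  \<open>\<omega>\<^sup>-\<^sup>1\<close> selects the terms \<open>\<phi>(B\<^sup>k\<^sup>+\<^sup>1 y\<^sub>i, B\<^sup>k y\<^sub>j)\<close>, whose sum telescopes to \<open>\<langle>By\<^sub>i, y\<^sub>j\<rangle>\<close>, both up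
  to a remainder that tends to \<open>0\<close> as the number of powers of \<open>B\<close> grows. This is the
  unitary dilation of a contraction in disguise: the \<open>\<omega>\<close> play the part of the spectrum of the
  unitary operator. Scaling removes the restriction to strict contractions, and density extends the
  bound to the completed tensor product.
\<close>

section \<open>Sums in inner products\<close>

lemma cinner_sum_right: "cinner x (\<Sum>i\<in>I. f i) = (\<Sum>i\<in>I. cinner x (f i))"
  by (induction I rule: infinite_finite_induct) (simp_all add: cinner_add_right)

lemma clinear_sum:
  assumes "clinear f"
  shows "f (\<Sum>i\<in>I. c i *\<^sub>C x i) = (\<Sum>i\<in>I. c i *\<^sub>C f (x i))"
  by (induction I rule: infinite_finite_induct) (simp_all add: clinear_simps[OF assms])

lemma cinner_clinear_sum:
  assumes "clinear A"
  shows "cinner (A (\<Sum>i\<in>I. c i *\<^sub>C x i)) (\<Sum>i\<in>I. c i *\<^sub>C x i) =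
    (\<Sum>i\<in>I. \<Sum>j\<in>I. cinner (A (x i)) (x j) * (c i * cnj (c j)))"
  by (subst sum.swap)
    (simp add: clinear_sum[OF assms] cinner_sum_left cinner_sum_right cinner_scaleC_left
      cinner_scaleC_right algebra_simps sum_distrib_left)

lemma norm_sq_eq_Re_cinner: "(norm (x :: 'a::complex_inner))\<^sup>2 = Re (cinner x x)"
  by (metis norm_sq_cinner Re_complex_of_real)

lemma tendsto_cinner:
  fixes X Y :: "nat \<Rightarrow> 'a::complex_inner"
  assumes X: "X \<longlonglongrightarrow> x" and Y: "Y \<longlonglongrightarrow> y"
  shows "(\<lambda>n. cinner (X n) (Y n)) \<longlonglongrightarrow> cinner x y"
proof -
  have "(\<lambda>n. cinner (X n - x) (Y n)) \<longlonglongrightarrow> 0"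
    using X Y by (intro cinner_null) (auto simp: LIM_zero_iff intro: convergent_imp_Bseq convergentI)
  moreover have "(\<lambda>n. cinner x (Y n - y)) \<longlonglongrightarrow> 0"
    using Y by (intro cinner_null) (auto simp: LIM_zero_iff Bseq_def intro: exI[of _ "norm x + 1"] add_nonneg_pos)
  ultimately have "(\<lambda>n. cinner (X n - x) (Y n) + cinner x (Y n - y)) \<longlonglongrightarrow> 0 + 0"
    by (rule tendsto_add)
  hence "(\<lambda>n. cinner (X n) (Y n) - cinner x y) \<longlonglongrightarrow> 0"
    by (simp add: cinner_diff_left cinner_diff_right)
  thus ?thesis by (simp add: LIM_zero_iff)
qed

section \<open>The numerical radius\<close>

lemma bdd_above_numerical_values:
  assumes "bounded_clinear T"
  shows "bdd_above (insert 0 {cmod (cinner (T x) x) | x. norm x = 1})"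
proof -
  obtain M where M: "\<And>x. norm (T x) \<le> M * norm x"
    using assms by (auto simp: bounded_clinear_def)
  have "cmod (cinner (T x) x) \<le> M" if "norm x = 1" for x
    using Cauchy_Schwarz_cinner[of "T x" x] M[of x] that by simp
  thus ?thesis
    by (intro bdd_aboveI[of _ "max 0 M"]) fastforce
qed

lemma numerical_radius_nonneg:
  assumes "bounded_clinear T"
  shows "0 \<le> numerical_radius T"
  unfolding numerical_radius_def
  by (rule cSup_upper[OF _ bdd_above_numerical_values[OF assms]]) simp

lemma numerical_radius_leI:
  assumes "0 \<le> K" and "\<And>x. norm x = 1 \<Longrightarrow> cmod (cinner (T x) x) \<le> K"
  shows "numerical_radius T \<le> K"
  unfolding numerical_radius_def
  by (rule cSup_least) (use assms in auto)

lemma normalized: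
  fixes x :: "'a::complex_inner"
  assumes "x \<noteq> 0"
  obtains u where "norm u = 1" "x = complex_of_real (norm x) *\<^sub>C u"
proof
  show "norm (complex_of_real (inverse (norm x)) *\<^sub>C x) = 1"
    using assms by (simp add: norm_scaleC norm_inverse)
  show "x = complex_of_real (norm x) *\<^sub>C complex_of_real (inverse (norm x)) *\<^sub>C x"
    using assms by (simp add: scaleC_scaleC scaleC_one)
qed

lemma cmod_cinner_le_numerical_radius:
  assumes "bounded_clinear T"
  shows "cmod (cinner (T x) x) \<le> numerical_radius T * (norm x)\<^sup>2"
proof (cases "x = 0")
  case True
  thus ?thesis by simp
next
  case False
  then obtain u where u: "norm u = 1" and x: "x = complex_of_real (norm x) *\<^sub>C u"
    by (rule normalized)
  have "cmod (cinner (T u) u) \<le> numerical_radius T"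
    unfolding numerical_radius_def
    by (rule cSup_upper[OF _ bdd_above_numerical_values[OF assms]]) (use u in auto)
  moreover have "cmod (cinner (T x) x) = cmod (cinner (T u) u) * (norm x)\<^sup>2"
    by (subst (1 2) x)
      (simp add: clinear_simps[OF bounded_clinear_clinear[OF assms]] cinner_scaleC_left
        cinner_scaleC_right norm_mult power2_eq_square)
  ultimately show ?thesis by (simp add: mult_right_mono)
qed

lemma bounded_clinear_diff_scaleC:
  assumes "bounded_clinear T"
  shows "bounded_clinear (\<lambda>x. T x - c *\<^sub>C x)"
proof -
  note lin = clinear_simps[OF bounded_clinear_clinear[OF assms]]
  obtain M where M: "\<And>x. norm (T x) \<le> M * norm x"
    using assms by (auto simp: bounded_clinear_def)
  have "norm (T x - c *\<^sub>C x) \<le> (M + cmod c) * norm x" for x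
    using norm_triangle_ineq4[of "T x" "c *\<^sub>C x"] M[of x] by (simp add: norm_scaleC algebra_simps)
  hence "\<exists>K. \<forall>x. norm (T x - c *\<^sub>C x) \<le> K * norm x" by blast
  moreover have "a *\<^sub>C (u - v) = a *\<^sub>C u - a *\<^sub>C v" for a and u v :: 'a
    using scaleC_add_right[of a "u - v" v] by (simp add: algebra_simps)
  ultimately show ?thesis
    unfolding bounded_clinear_def clinear_def
    by (auto simp: lin scaleC_add_right scaleC_scaleC mult.commute)
qed

lemma numerical_radius_dist_le:
  assumes "bounded_clinear T"
  shows "numerical_radius_dist T \<le> numerical_radius (\<lambda>x. T x - c *\<^sub>C x)"
  unfolding numerical_radius_dist_def
  by (rule cINF_lower)
    (auto intro!: bdd_belowI[of _ 0] numerical_radius_nonneg bounded_clinear_diff_scaleC assms)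

lemma numerical_radius_dist_nonneg:
  assumes "bounded_clinear T"
  shows "0 \<le> numerical_radius_dist T"
  unfolding numerical_radius_dist_def
  by (rule cINF_greatest) (auto intro!: numerical_radius_nonneg bounded_clinear_diff_scaleC assms)

section \<open>Operator norm\<close>

text \<open>
  Both pairs \<open>x \<plusminus> y\<close> and \<open>x \<plusminus> \<i>y\<close> satisfy the parallelogram law, with total \<open>4\<close>. When \<open>\<langle>x, y\<rangle>\<close>
  is real, \<open>x + \<i>y\<close> and \<open>x - \<i>y\<close> have in addition the same norm, so a multiple of the identity
  cancels from the difference of the values of the quadratic form there.
\<close>

lemma cmod_cinner_le_of_real_cinner:
  assumes T: "bounded_clinear T" and x: "norm x = 1" and y: "norm y = 1"
    and real: "Im (cinner x y) = 0"
  shows "cmod (cinner (T x) y) \<le> numerical_radius T + numerical_radius (\<lambda>x. T x - c *\<^sub>C x)"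
proof -
  note lin = clinear_simps[OF bounded_clinear_clinear[OF T]]
  define S where "S x = T x - c *\<^sub>C x" for x
  have S: "bounded_clinear S"
    unfolding S_def by (rule bounded_clinear_diff_scaleC[OF T])
  note linS = clinear_simps[OF bounded_clinear_clinear[OF S]]
  define q where "q R z = cinner (R z) z" for R :: "'a \<Rightarrow> 'a" and z
  have yx: "cinner y x = cinner x y"
    using cinner_commute[of y x] real by (simp add: complex_eq_iff)
  have xx: "cinner x x = 1" "cinner y y = 1"
    using norm_sq_cinner[of x] norm_sq_cinner[of y] x y by simp_all
  have parallelogram: "(norm (x + y))\<^sup>2 + (norm (x - y))\<^sup>2 = 4"
    "(norm (x + \<i> *\<^sub>C y))\<^sup>2 + (norm (x - \<i> *\<^sub>C y))\<^sup>2 = 4"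
    by (simp_all add: norm_sq_eq_Re_cinner cinner_add_left cinner_add_right cinner_diff_left cinner_diff_right
        cinner_scaleC_left cinner_scaleC_right xx)
  have "4 * cinner (T x) y = (q T (x + y) - q T (x - y)) +
      \<i> * (q T (x + \<i> *\<^sub>C y) - q T (x - \<i> *\<^sub>C y))"
    by (simp add: q_def lin cinner_add_left cinner_add_right cinner_diff_left cinner_diff_right
        cinner_scaleC_left cinner_scaleC_right algebra_simps)
  also have "q T (x + \<i> *\<^sub>C y) - q T (x - \<i> *\<^sub>C y) = q S (x + \<i> *\<^sub>C y) - q S (x - \<i> *\<^sub>C y)"
    by (simp add: q_def S_def cinner_add_left cinner_add_right cinner_diff_left cinner_diff_right
        cinner_scaleC_left cinner_scaleC_right xx yx algebra_simps)
  finally have eq: "4 * cinner (T x) y = (q T (x + y) - q T (x - y)) +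
      \<i> * (q S (x + \<i> *\<^sub>C y) - q S (x - \<i> *\<^sub>C y))" .
  have "cmod (4 * cinner (T x) y) \<le>
      (cmod (q T (x + y)) + cmod (q T (x - y))) +
      (cmod (q S (x + \<i> *\<^sub>C y)) + cmod (q S (x - \<i> *\<^sub>C y)))"
    unfolding eq
    by (rule norm_triangle_mono)
      (simp_all only: norm_mult norm_ii mult_1 norm_triangle_ineq4)
  also have "\<dots> \<le> numerical_radius T * ((norm (x + y))\<^sup>2 + (norm (x - y))\<^sup>2) +
      numerical_radius S * ((norm (x + \<i> *\<^sub>C y))\<^sup>2 + (norm (x - \<i> *\<^sub>C y))\<^sup>2)"
    unfolding q_def distrib_left by (intro add_mono cmod_cinner_le_numerical_radius T S)
  finally show ?thesis
    unfolding parallelogram by (simp add: norm_mult S_def[abs_def])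
qed

text \<open>
  Take \<open>y\<close> in the direction of \<open>Tx\<close>. Its phase is free, and multiplying it by the sign of \<open>\<langle>x, y\<rangle>\<close>
  makes that inner product real without changing \<open>\<bar>\<langle>Tx, y\<rangle>\<bar>\<close>.
\<close>

lemma norm_le_numerical_radius_add_dist:
  assumes T: "bounded_clinear T"
  shows "norm (T x) \<le> (numerical_radius T + numerical_radius_dist T) * norm x"
proof (cases "x = 0 \<or> T x = 0")
  case True
  thus ?thesis
    using numerical_radius_nonneg[OF T] numerical_radius_dist_nonneg[OF T]
      clinear_simps(3)[OF bounded_clinear_clinear[OF T]] by auto
next
  case False
  note lin = clinear_simps[OF bounded_clinear_clinear[OF T]]
  obtain u where u: "norm u = 1" "x = complex_of_real (norm x) *\<^sub>C u"
    using False normalized by blast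
  obtain v where v: "norm v = 1" "T x = complex_of_real (norm (T x)) *\<^sub>C v"
    using False normalized by blast
  define s where "s = (if cinner u v = 0 then 1 else sgn (cinner u v))"
  have s: "cmod s = 1" "Im (cinner u (s *\<^sub>C v)) = 0"
    by (auto simp: s_def cinner_scaleC_right sgn_eq norm_divide)
  have "cinner (complex_of_real (norm (T x)) *\<^sub>C v) v = complex_of_real (norm (T x))"
    using v(1) norm_sq_cinner[of v] by (simp add: cinner_scaleC_left)
  hence "cinner (T x) v = complex_of_real (norm (T x))"
    by (simp flip: v(2))
  moreover have "cinner (T x) v = complex_of_real (norm x) * cinner (T u) v"
    by (subst u(2)) (simp add: lin cinner_scaleC_left)
  ultimately have "cmod (complex_of_real (norm (T x))) = cmod (complex_of_real (norm x) * cinner (T u) v)"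
    by simp
  hence "norm (T x) = norm x * cmod (cinner (T u) (s *\<^sub>C v))"
    using s(1) by (simp add: cinner_scaleC_right norm_mult)
  moreover have "cmod (cinner (T u) (s *\<^sub>C v)) - numerical_radius T \<le> numerical_radius_dist T"
    unfolding numerical_radius_dist_def
  proof (rule cINF_greatest)
    fix c
    show "cmod (cinner (T u) (s *\<^sub>C v)) - numerical_radius T \<le> numerical_radius (\<lambda>x. T x - c *\<^sub>C x)"
      using cmod_cinner_le_of_real_cinner[OF T u(1) _ s(2)] v(1) s(1)
      by (simp add: norm_scaleC algebra_simps)
  qed simp
  ultimately show ?thesis
    by (simp add: mult.commute mult_left_mono)
qed

section \<open>Positive semidefinite forms\<close>

locale psd_form =
  fixes \<phi> :: "'b::complex_vector \<Rightarrow> 'b \<Rightarrow> complex"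
  assumes add_left: "\<phi> (u + v) z = \<phi> u z + \<phi> v z"
    and scaleC_left: "\<phi> (c *\<^sub>C u) z = c * \<phi> u z"
    and hermitian: "\<phi> u v = cnj (\<phi> v u)"
    and nonneg: "0 \<le> Re (\<phi> u u)"
begin

lemma add_right: "\<phi> z (u + v) = \<phi> z u + \<phi> z v"
  by (metis add_left hermitian complex_cnj_add)

lemma scaleC_right: "\<phi> z (c *\<^sub>C u) = cnj c * \<phi> z u"
  by (metis scaleC_left hermitian complex_cnj_mult)

lemma sum_sum:
  assumes "finite K" "finite M"
  shows "\<phi> (\<Sum>k\<in>K. a k *\<^sub>C u k) (\<Sum>m\<in>M. b m *\<^sub>C v m) =
    (\<Sum>k\<in>K. \<Sum>m\<in>M. a k * cnj (b m) * \<phi> (u k) (v m))"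
proof -
  have zero: "\<phi> 0 z = 0" "\<phi> z 0 = 0" for z
    using scaleC_left[of 0 0 z] scaleC_right[of z 0 0] by simp_all
  have r: "\<phi> z (\<Sum>m\<in>M. b m *\<^sub>C v m) = (\<Sum>m\<in>M. cnj (b m) * \<phi> z (v m))" for z
    using assms(2) by induction (simp_all add: zero add_right scaleC_right)
  show ?thesis
    using assms(1) by induction (simp_all add: zero add_left scaleC_left r sum_distrib_left sum.distrib
        distrib_left mult_ac)
qed

lemma self_real: "\<phi> u u = complex_of_real (Re (\<phi> u u))"
  using arg_cong[OF hermitian[of u u], of Im] by (simp add: complex_eq_iff)

lemma expand:
  "Re (\<phi> (u + c *\<^sub>C v) (u + c *\<^sub>C v)) =
    Re (\<phi> u u) + 2 * Re (c * \<phi> v u) + (cmod c)\<^sup>2 * Re (\<phi> v v)"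
proof -
  have "Re (cnj c * \<phi> u v) = Re (c * \<phi> v u)"
    by (subst hermitian) simp
  moreover have "Re (c * (cnj c * \<phi> v v)) = (cmod c)\<^sup>2 * Re (\<phi> v v)"
    using self_real[of v]
    by (metis Re_complex_of_real complex_norm_square mult.assoc of_real_mult)
  ultimately show ?thesis
    by (simp add: add_left add_right scaleC_left scaleC_right algebra_simps)
qed

text \<open>
  The quadratic form on the line \<open>u + r \<phi>(u, v) v\<close>, with \<open>r\<close> real, is affine in \<open>r\<close> when \<open>v\<close> is a
  null vector, and an affine function that stays nonnegative is constant.
\<close>

lemma null:
  assumes "\<phi> v v = 0"
  shows "\<phi> v u = 0" "\<phi> u v = 0"
proof -
  define p where "p = (cmod (\<phi> v u))\<^sup>2"
  \<comment> \<open>At \<open>r = t / p\<close> the affine function would be negative: it would be at most \<open>-2\<close>.\<close>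
  define t where "t = - (Re (\<phi> u u) + 1)"
  have *: "Re (complex_of_real r * cnj (\<phi> v u) * \<phi> v u) = r * p" for r
  proof -
    have "cnj (\<phi> v u) * \<phi> v u = complex_of_real p"
      unfolding p_def complex_norm_square by (rule mult.commute)
    thus ?thesis by (simp add: mult.assoc)
  qed
  have "0 \<le> Re (\<phi> u u) + 2 * (r * p)" for r
    using nonneg[of "u + (complex_of_real r * cnj (\<phi> v u)) *\<^sub>C v"]
    unfolding expand * by (simp add: assms)
  from this[of "t / p"] have "p = 0"
    using nonneg[of u] by (cases "p = 0") (simp_all add: t_def)
  thus "\<phi> v u = 0" by (simp add: p_def)
  thus "\<phi> u v = 0" by (subst hermitian) simp
qed

text \<open>
  The value of the new form at \<open>u\<close> is the old value at the component of \<open>u\<close> that is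
  \<open>\<phi>\<close>-orthogonal to \<open>v\<close>.
\<close>

lemma schur_complement:
  assumes "\<phi> v v \<noteq> 0"
  shows "psd_form (\<lambda>u z. \<phi> u z - \<phi> u v * \<phi> v z / \<phi> v v)"
proof
  define g where "g = Re (\<phi> v v)"
  have g: "\<phi> v v = complex_of_real g" "g \<noteq> 0"
    using assms self_real[of v] by (auto simp: g_def)
  fix u z w :: 'b and c :: complex
  show "\<phi> (u + w) z - \<phi> (u + w) v * \<phi> v z / \<phi> v v =
      \<phi> u z - \<phi> u v * \<phi> v z / \<phi> v v + (\<phi> w z - \<phi> w v * \<phi> v z / \<phi> v v)"
    by (simp add: add_left add_divide_distrib algebra_simps)
  show "\<phi> (c *\<^sub>C u) z - \<phi> (c *\<^sub>C u) v * \<phi> v z / \<phi> v v =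
      c * (\<phi> u z - \<phi> u v * \<phi> v z / \<phi> v v)"
    by (simp add: scaleC_left algebra_simps)
  show "\<phi> u z - \<phi> u v * \<phi> v z / \<phi> v v = cnj (\<phi> z u - \<phi> z v * \<phi> v u / \<phi> v v)"
    using hermitian[of u z] hermitian[of u v] hermitian[of v z] by (simp add: g mult.commute)
  have uv: "\<phi> u v * \<phi> v u = complex_of_real ((cmod (\<phi> v u))\<^sup>2)"
    using hermitian[of u v] complex_norm_square[of "\<phi> v u"] by (simp add: mult.commute)
  define d where "d = - cnj (\<phi> v u) / complex_of_real g"
  have d: "d * \<phi> v u = complex_of_real (- (cmod (\<phi> v u))\<^sup>2 / g)"
    using complex_norm_square[of "\<phi> v u"] by (simp add: d_def mult.commute)
  have "(cmod d)\<^sup>2 * g = (cmod (\<phi> v u))\<^sup>2 / g"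
    using g(2) by (simp add: d_def norm_divide power_divide field_simps power2_eq_square)
  hence "Re (\<phi> (u + d *\<^sub>C v) (u + d *\<^sub>C v)) = Re (\<phi> u u) - (cmod (\<phi> v u))\<^sup>2 / g"
    unfolding expand d g_def[symmetric] by simp
  thus "0 \<le> Re (\<phi> u u - \<phi> u v * \<phi> v u / \<phi> v v)"
    using nonneg[of "u + d *\<^sub>C v"] unfolding uv g by simp
qed

end

text \<open>
  The induction peels off one \<open>y\<^sub>k\<close> as in the Cholesky decomposition. The rank one form
  \<open>\<phi>(u, y\<^sub>k) \<phi>(y\<^sub>k, z) / \<phi>(y\<^sub>k, y\<^sub>k)\<close> contributes a multiple of \<open>\<langle>Ap, p\<rangle>\<close> for a single vector \<open>p\<close>, to
  which the hypothesis on \<open>A\<close> applies. What is left of \<open>\<phi>\<close> is positive semidefinite and vanishes at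
  \<open>y\<^sub>k\<close>, so that the induction hypothesis covers it; this is why \<open>\<phi>\<close> is arbitrary in the induction.
\<close>

lemma psd_form_tensor_bound:
  fixes A :: "'a::complex_inner \<Rightarrow> 'a" and y :: "'i \<Rightarrow> 'b::complex_vector"
  assumes A: "clinear A" and w: "\<And>x. cmod (cinner (A x) x) \<le> w * (norm x)\<^sup>2"
    and "finite I" "psd_form \<phi>"
  shows "cmod (\<Sum>i\<in>I. \<Sum>j\<in>I. cinner (A (x i)) (x j) * \<phi> (y i) (y j)) \<le>
    w * Re (\<Sum>i\<in>I. \<Sum>j\<in>I. cinner (x i) (x j) * \<phi> (y i) (y j))"
  using assms(3,4)
proof (induction I arbitrary: \<phi>)
  case empty
  show ?case by simp
next
  case (insert k I)
  interpret psd_form \<phi> by fact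
  let ?J = "insert k I"
  show ?case
  proof (cases "\<phi> (y k) (y k) = 0")
    case True
    show ?thesis
      using insert.IH[OF insert.prems] insert.hyps by (simp add: null[OF True])
  next
    case False
    define g where "g = Re (\<phi> (y k) (y k))"
    have g: "\<phi> (y k) (y k) = complex_of_real g" "g > 0"
      using False self_real[of "y k"] nonneg[of "y k"] by (auto simp: g_def less_le)
    define \<psi> where "\<psi> u z = \<phi> u z - \<phi> u (y k) * \<phi> (y k) z / \<phi> (y k) (y k)" for u z
    have psi: "psd_form \<psi>"
      unfolding \<psi>_def by (rule schur_complement[OF False])
    have psi0: "\<psi> (y k) z = 0" "\<psi> z (y k) = 0" for z
      using False by (simp_all add: \<psi>_def)
    define p where "p = (\<Sum>i\<in>?J. \<phi> (y i) (y k) *\<^sub>C x i)"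
    \<comment> \<open>Needed for \<open>A\<close> on the left of the claim and for the identity on its right.\<close>
    have split: "(\<Sum>i\<in>?J. \<Sum>j\<in>?J. cinner (T (x i)) (x j) * \<phi> (y i) (y j)) =
        (\<Sum>i\<in>I. \<Sum>j\<in>I. cinner (T (x i)) (x j) * \<psi> (y i) (y j)) +
        cinner (T p) p / complex_of_real g"
      if T: "clinear T" for T :: "'a \<Rightarrow> 'a"
    proof -
      have dec: "\<phi> u z = \<psi> u z + \<phi> u (y k) * cnj (\<phi> z (y k)) / complex_of_real g" for u z
        using g hermitian[of "y k" z] by (simp add: \<psi>_def)
      have "(\<Sum>i\<in>?J. \<Sum>j\<in>?J. cinner (T (x i)) (x j) * \<phi> (y i) (y j)) =
          (\<Sum>i\<in>?J. \<Sum>j\<in>?J. cinner (T (x i)) (x j) * (\<psi> (y i) (y j) +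
            \<phi> (y i) (y k) * cnj (\<phi> (y j) (y k)) / complex_of_real g))"
        by (intro sum.cong refl arg_cong2[of _ _ _ _ "(*)"] dec)
      also have "\<dots> = (\<Sum>i\<in>?J. \<Sum>j\<in>?J. cinner (T (x i)) (x j) * \<psi> (y i) (y j)) +
          (\<Sum>i\<in>?J. \<Sum>j\<in>?J. cinner (T (x i)) (x j) *
            (\<phi> (y i) (y k) * cnj (\<phi> (y j) (y k)))) / complex_of_real g"
        by (simp only: distrib_left sum.distrib sum_divide_distrib times_divide_eq_right)
      also have "(\<Sum>i\<in>?J. \<Sum>j\<in>?J. cinner (T (x i)) (x j) *
            (\<phi> (y i) (y k) * cnj (\<phi> (y j) (y k)))) = cinner (T p) p"
        unfolding p_def by (rule cinner_clinear_sum[OF T, symmetric])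
      also have "(\<Sum>i\<in>?J. \<Sum>j\<in>?J. cinner (T (x i)) (x j) * \<psi> (y i) (y j)) =
          (\<Sum>i\<in>I. \<Sum>j\<in>I. cinner (T (x i)) (x j) * \<psi> (y i) (y j))"
        using insert.hyps by (simp add: psi0)
      finally show ?thesis .
    qed
    have "cmod (\<Sum>i\<in>?J. \<Sum>j\<in>?J. cinner (A (x i)) (x j) * \<phi> (y i) (y j)) \<le>
        cmod (\<Sum>i\<in>I. \<Sum>j\<in>I. cinner (A (x i)) (x j) * \<psi> (y i) (y j)) + cmod (cinner (A p) p) / g"
      unfolding split[OF A] using g by (intro norm_triangle_le) (simp add: norm_divide)
    also have "\<dots> \<le> w * Re (\<Sum>i\<in>I. \<Sum>j\<in>I. cinner (x i) (x j) * \<psi> (y i) (y j)) + w * (norm p)\<^sup>2 / g"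
      using g w[of p] by (intro add_mono insert.IH psi divide_right_mono) auto
    also have "\<dots> = w * Re (\<Sum>i\<in>?J. \<Sum>j\<in>?J. cinner (x i) (x j) * \<phi> (y i) (y j))"
      using split[of "\<lambda>x. x"]
      by (simp add: clinear_def algebra_simps flip: norm_sq_cinner of_real_power of_real_divide)
    finally show ?thesis .
  qed
qed

section \<open>Averaging over roots of unity\<close>

text \<open>
  The restriction to \<open>j, k < M\<close> ensures that \<open>j\<close> and \<open>k\<close> are congruent modulo \<open>M\<close> only when they are
  equal.
\<close>

lemma sum_roots_of_unity_orthogonal:
  fixes M :: nat
  assumes "j < M" "k < M"
  shows "(\<Sum>l<M. cis (2 * pi * l / M) ^ j * cnj (cis (2 * pi * l / M)) ^ k) =
    (if j = k then of_nat M else 0)"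
proof -
  have M: "M > 0" using assms by simp
  define z where "z = cis (2 * pi * (real j - real k) / M)"
  have summand: "cis (2 * pi * l / M) ^ j * cnj (cis (2 * pi * l / M)) ^ k = z ^ l" for l :: nat
    unfolding z_def cis_cnj Complex.DeMoivre cis_mult
    by (rule arg_cong[of _ _ cis]) (use M in \<open>simp add: field_simps\<close>)
  have "z = 1" if "j = k" using that by (simp add: z_def)
  moreover have "(\<Sum>l<M. z ^ l) = 0" if "j \<noteq> k"
  proof -
    have "z ^ M = cis (2 * pi * real_of_int (int j - int k))"
      using M by (simp add: z_def Complex.DeMoivre)
    also have "\<dots> = 1" by (rule cis_multiple_2pi) simp
    finally have "z ^ M = 1" .
    moreover have "z \<noteq> 1"
    proof
      assume "z = 1"
      hence "cos (2 * pi * (real j - real k) / M) = 1"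
        by (simp add: z_def complex_eq_iff)
      then obtain n :: int where "2 * pi * (real j - real k) / M = of_int n * (2 * pi)"
        unfolding cos_one_2pi_int by (auto simp: algebra_simps)
      hence "(2 * pi) * (real j - real k) = (2 * pi) * (of_int n * real M)"
        using M by (simp add: field_simps)
      hence "real j - real k = of_int n * real M"
        by (subst (asm) mult_cancel_left) simp
      hence "real_of_int (int j - int k) = real_of_int (n * int M)" by simp
      hence n: "int j - int k = n * int M" by (simp only: of_int_eq_iff)
      hence "\<bar>n\<bar> * int M < 1 * int M"
        using assms abs_mult[of n "int M"] by linarith
      thus False using n that M by auto
    qed
    ultimately show ?thesis by (simp add: geometric_sum)
  qed
  ultimately show ?thesis unfolding summand by auto
qed

section \<open>Contractions\<close>

lemma psd_form_defect:
  fixes B :: "'a::complex_inner \<Rightarrow> 'b::complex_inner"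
  assumes "clinear B" "\<And>y. norm (B y) \<le> norm y"
  shows "psd_form (\<lambda>u v. cinner u v - cinner (B u) (B v))"
proof
  fix u v z :: 'a and c :: complex
  show "cinner (u + v) z - cinner (B (u + v)) (B z) =
      cinner u z - cinner (B u) (B z) + (cinner v z - cinner (B v) (B z))"
    by (simp add: clinear_simps[OF assms(1)] cinner_add_left)
  show "cinner (c *\<^sub>C u) z - cinner (B (c *\<^sub>C u)) (B z) = c * (cinner u z - cinner (B u) (B z))"
    by (simp add: clinear_simps[OF assms(1)] cinner_scaleC_left algebra_simps)
  show "cinner u v - cinner (B u) (B v) = cnj (cinner v u - cinner (B v) (B u))"
    by (simp flip: cinner_commute)
  have "Re (cinner (B u) (B u)) \<le> Re (cinner u u)"
    unfolding norm_sq_eq_Re_cinner[symmetric] by (intro power_mono assms) auto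
  thus "0 \<le> Re (cinner u u - cinner (B u) (B u))" by simp
qed

text \<open>
  The sum \<open>f\<close> over the powers of \<open>B\<close> has \<open>n + 1\<close> terms, so each telescoping sum leaves one remainder
  with the highest power of \<open>B\<close>. The average over the roots of unity of the bound for the defect form
  is exact: no other error occurs.
\<close>

lemma truncated_tensor_bound:
  fixes A :: "'a::complex_inner \<Rightarrow> 'a" and B :: "'b::complex_inner \<Rightarrow> 'b"
  assumes A: "clinear A" and w: "\<And>x. cmod (cinner (A x) x) \<le> w * (norm x)\<^sup>2"
    and B: "clinear B" "\<And>y. norm (B y) \<le> norm y" and I: "finite I"
  shows "cmod (\<Sum>i\<in>I. \<Sum>j\<in>I. cinner (A (x i)) (x j) *
      (cinner (B (y i)) (y j) - cinner ((B ^^ Suc n) (y i)) ((B ^^ n) (y j)))) \<le>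
    w * Re (\<Sum>i\<in>I. \<Sum>j\<in>I. cinner (x i) (x j) *
      (cinner (y i) (y j) - cinner ((B ^^ Suc n) (y i)) ((B ^^ Suc n) (y j))))"
    (is "cmod ?L \<le> w * Re ?R")
proof -
  define \<phi> where "\<phi> u v = cinner u v - cinner (B u) (B v)" for u v
  interpret psd_form \<phi>
    unfolding \<phi>_def by (rule psd_form_defect[OF B])
  \<comment> \<open>The exponents \<open>k \<le> n\<close> and \<open>m + s \<le> n + 1\<close> compared in \<open>avg\<close> must stay below \<open>M\<close>.\<close>
  define M where "M = Suc (Suc n)"
  define \<omega> where "\<omega> l = cis (2 * pi * real l / real M)" for l
  define f where "f l u = (\<Sum>k<Suc n. \<omega> l ^ k *\<^sub>C (B ^^ k) u)" for l u
  have f: "\<phi> (f l u) (f l v) =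
      (\<Sum>k<Suc n. \<Sum>m<Suc n. \<omega> l ^ k * cnj (\<omega> l) ^ m * \<phi> ((B ^^ k) u) ((B ^^ m) v))" for l u v
    unfolding f_def by (simp add: sum_sum del: sum.lessThan_Suc)
  have orth: "(\<Sum>l<M. \<omega> l ^ k * cnj (\<omega> l) ^ m) = (if k = m then of_nat M else 0)"
    if "k < M" "m < M" for k m
    unfolding \<omega>_def by (rule sum_roots_of_unity_orthogonal[OF that])
  have avg: "(\<Sum>l<M. cnj (\<omega> l) ^ s * \<phi> (f l u) (f l v)) =
      (\<Sum>m<Suc n. \<Sum>k<Suc n. (if k = m + s then of_nat M else 0) * \<phi> ((B ^^ k) u) ((B ^^ m) v))"
    if "s \<le> 1" for s u v
  proof -
    have "(\<Sum>l<M. cnj (\<omega> l) ^ s * \<phi> (f l u) (f l v)) =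
        (\<Sum>l<M. \<Sum>k<Suc n. \<Sum>m<Suc n.
          \<omega> l ^ k * cnj (\<omega> l) ^ (m + s) * \<phi> ((B ^^ k) u) ((B ^^ m) v))"
      unfolding f sum_distrib_left by (simp add: power_add mult_ac del: sum.lessThan_Suc)
    also have "\<dots> = (\<Sum>k<Suc n. \<Sum>m<Suc n. \<Sum>l<M.
          \<omega> l ^ k * cnj (\<omega> l) ^ (m + s) * \<phi> ((B ^^ k) u) ((B ^^ m) v))"
      by (subst sum.swap, rule sum.cong[OF refl], rule sum.swap)
    also have "\<dots> = (\<Sum>k<Suc n. \<Sum>m<Suc n. 
          (if k = m + s then of_nat M else 0) * \<phi> ((B ^^ k) u) ((B ^^ m) v))"
      unfolding sum_distrib_right[symmetric]
      by (intro sum.cong refl arg_cong2[of _ _ _ _ "(*)"] orth) (use that in \<open>auto simp: M_def\<close>)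
    finally show ?thesis by (subst sum.swap)
  qed
  have avg0: "(\<Sum>l<M. \<phi> (f l u) (f l v)) =
      of_nat M * (cinner u v - cinner ((B ^^ Suc n) u) ((B ^^ Suc n) v))" for u v
  proof -
    have "(\<Sum>l<M. \<phi> (f l u) (f l v)) = (\<Sum>m<Suc n. of_nat M * \<phi> ((B ^^ m) u) ((B ^^ m) v))"
      using avg[of 0 u v] by (simp add: if_distrib[of "\<lambda>c. c * _"] sum.delta' cong: if_cong del: sum.lessThan_Suc)
    also have "\<dots> = of_nat M * (\<Sum>m<Suc n. cinner ((B ^^ m) u) ((B ^^ m) v) -
        cinner ((B ^^ Suc m) u) ((B ^^ Suc m) v))"
      by (simp add: \<phi>_def sum_distrib_left del: sum.lessThan_Suc)
    also have "\<dots> = of_nat M * (cinner u v - cinner ((B ^^ Suc n) u) ((B ^^ Suc n) v))"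
      by (subst sum_lessThan_telescope') simp
    finally show ?thesis .
  qed
  have avg1: "(\<Sum>l<M. cnj (\<omega> l) * \<phi> (f l u) (f l v)) =
      of_nat M * (cinner (B u) v - cinner ((B ^^ Suc n) u) ((B ^^ n) v))" for u v
  proof -
    have "(\<Sum>l<M. cnj (\<omega> l) * \<phi> (f l u) (f l v)) =
        (\<Sum>m<Suc n. if Suc m < Suc n then of_nat M * \<phi> ((B ^^ Suc m) u) ((B ^^ m) v) else 0)"
      using avg[of 1 u v] by (simp add: if_distrib[of "\<lambda>c. c * _"] sum.delta' cong: if_cong del: sum.lessThan_Suc)
    also have "\<dots> = (\<Sum>m<n. of_nat M * \<phi> ((B ^^ Suc m) u) ((B ^^ m) v))"
      by simp
    also have "\<dots> = of_nat M * (\<Sum>m<n. cinner ((B ^^ Suc m) u) ((B ^^ m) v) -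
        cinner ((B ^^ Suc (Suc m)) u) ((B ^^ Suc m) v))"
      by (simp add: \<phi>_def sum_distrib_left)
    also have "\<dots> = of_nat M * (cinner (B u) v - cinner ((B ^^ Suc n) u) ((B ^^ n) v))"
      by (subst sum_lessThan_telescope') simp
    finally show ?thesis .
  qed
  define G where "G T l = (\<Sum>i\<in>I. \<Sum>j\<in>I. cinner (T (x i)) (x j) * \<phi> (f l (y i)) (f l (y j)))"
    for T :: "'a \<Rightarrow> 'a" and l
  have swap: "(\<Sum>l<M. c l * G T l) =
      (\<Sum>i\<in>I. \<Sum>j\<in>I. cinner (T (x i)) (x j) * (\<Sum>l<M. c l * \<phi> (f l (y i)) (f l (y j))))" for c T
    unfolding G_def sum_distrib_left
    by (subst sum.swap, rule sum.cong[OF refl], subst sum.swap) (simp add: mult_ac)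
  have L: "(\<Sum>l<M. cnj (\<omega> l) * G A l) = of_nat M * ?L"
    unfolding swap avg1 by (simp add: sum_distrib_left mult_ac)
  have R: "(\<Sum>l<M. G (\<lambda>x. x) l) = of_nat M * ?R"
    using swap[of "\<lambda>_. 1" "\<lambda>x. x"] by (simp add: avg0 sum_distrib_left mult_ac)
  have "real M * cmod ?L \<le> (\<Sum>l<M. cmod (cnj (\<omega> l) * G A l))"
    using norm_sum[of "\<lambda>l. cnj (\<omega> l) * G A l" "{..<M}"] unfolding L by (simp add: norm_mult)
  also have "\<dots> = (\<Sum>l<M. cmod (G A l))"
    by (simp add: norm_mult \<omega>_def)
  also have "\<dots> \<le> (\<Sum>l<M. w * Re (G (\<lambda>x. x) l))"
    unfolding G_def by (intro sum_mono psd_form_tensor_bound A w I psd_form_axioms)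
  also have "\<dots> = real M * (w * Re ?R)"
    using arg_cong[OF R, of Re] by (simp flip: sum_distrib_left)
  finally show ?thesis
    by (simp add: M_def)
qed

text \<open>
  Strictness makes the powers of \<open>B\<close> tend to \<open>0\<close>, so both remainders vanish in the limit.
\<close>

lemma strict_contraction_tensor_bound:
  fixes A :: "'a::complex_inner \<Rightarrow> 'a" and B :: "'b::complex_inner \<Rightarrow> 'b"
  assumes A: "clinear A" and w: "\<And>x. cmod (cinner (A x) x) \<le> w * (norm x)\<^sup>2"
    and B: "clinear B" "\<And>y. norm (B y) \<le> r * norm y" and r: "0 \<le> r" "r < 1" and I: "finite I"
  shows "cmod (\<Sum>i\<in>I. \<Sum>j\<in>I. cinner (A (x i)) (x j) * cinner (B (y i)) (y j)) \<le>
    w * Re (\<Sum>i\<in>I. \<Sum>j\<in>I. cinner (x i) (x j) * cinner (y i) (y j))"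
proof -
  have contr: "norm (B u) \<le> norm u" for u
    using B(2)[of u] r mult_right_mono[of r 1 "norm u"] by simp
  have pow: "norm ((B ^^ n) u) \<le> r ^ n * norm u" for n u
  proof (induction n)
    case (Suc n)
    have "norm (B ((B ^^ n) u)) \<le> r * (r ^ n * norm u)"
      using B(2)[of "(B ^^ n) u"] mult_left_mono[OF Suc r(1)] by linarith
    thus ?case by simp
  qed simp
  have lim: "(\<lambda>n. (B ^^ n) u) \<longlonglongrightarrow> 0" for u
  proof (rule Lim_null_comparison[OF always_eventually])
    show "(\<lambda>n. r ^ n * norm u) \<longlonglongrightarrow> 0"
      using r by (intro tendsto_mult_left_zero LIMSEQ_power_zero) simp
  qed (use pow in blast)
  note lim' = LIMSEQ_Suc[OF lim]
  show ?thesis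
  proof (rule LIMSEQ_le)
    show "\<exists>N. \<forall>n\<ge>N. cmod (\<Sum>i\<in>I. \<Sum>j\<in>I. cinner (A (x i)) (x j) *
          (cinner (B (y i)) (y j) - cinner ((B ^^ Suc n) (y i)) ((B ^^ n) (y j)))) \<le>
        w * Re (\<Sum>i\<in>I. \<Sum>j\<in>I. cinner (x i) (x j) *
          (cinner (y i) (y j) - cinner ((B ^^ Suc n) (y i)) ((B ^^ Suc n) (y j))))"
      using truncated_tensor_bound[OF A w B(1) contr I] by blast
    have *: "(\<lambda>n. \<Sum>i\<in>I. \<Sum>j\<in>I. cinner (T (x i)) (x j) *
          (c i j - cinner ((B ^^ Suc n) (y i)) (V n j))) \<longlonglongrightarrow>
        (\<Sum>i\<in>I. \<Sum>j\<in>I. cinner (T (x i)) (x j) * (c i j - cinner (0 :: 'b) 0))"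
      if "\<And>j. (\<lambda>n. V n j) \<longlonglongrightarrow> 0" for T :: "'a \<Rightarrow> 'a" and c :: "'c \<Rightarrow> 'c \<Rightarrow> complex" and V
      by (intro tendsto_sum tendsto_mult tendsto_const tendsto_diff tendsto_cinner lim' that)
    show "(\<lambda>n. cmod (\<Sum>i\<in>I. \<Sum>j\<in>I. cinner (A (x i)) (x j) *
          (cinner (B (y i)) (y j) - cinner ((B ^^ Suc n) (y i)) ((B ^^ n) (y j))))) \<longlonglongrightarrow>
        cmod (\<Sum>i\<in>I. \<Sum>j\<in>I. cinner (A (x i)) (x j) * cinner (B (y i)) (y j))"
      using tendsto_norm[OF *[of "\<lambda>n j. (B ^^ n) (y j)" A "\<lambda>i j. cinner (B (y i)) (y j)", OF lim]]
      by simp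
    show "(\<lambda>n. w * Re (\<Sum>i\<in>I. \<Sum>j\<in>I. cinner (x i) (x j) *
          (cinner (y i) (y j) - cinner ((B ^^ Suc n) (y i)) ((B ^^ Suc n) (y j))))) \<longlonglongrightarrow>
        w * Re (\<Sum>i\<in>I. \<Sum>j\<in>I. cinner (x i) (x j) * cinner (y i) (y j))"
      using tendsto_mult_left[OF tendsto_Re[OF *[of "\<lambda>n j. (B ^^ Suc n) (y j)" "\<lambda>x. x"
            "\<lambda>i j. cinner (y i) (y j)", OF lim']], of w]
      by simp
  qed
qed

text \<open>
  For every \<open>c > b\<close> the operator \<open>B / c\<close> is a strict contraction; then \<open>c\<close> tends to \<open>b\<close>. Going through
  \<open>c > b\<close> also covers \<open>b = 0\<close>.
\<close>

lemma tensor_sum_bound: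
  fixes A :: "'a::complex_inner \<Rightarrow> 'a" and B :: "'b::complex_inner \<Rightarrow> 'b"
  assumes A: "clinear A" and w: "\<And>x. cmod (cinner (A x) x) \<le> w * (norm x)\<^sup>2"
    and B: "clinear B" "\<And>y. norm (B y) \<le> b * norm y" and b: "0 \<le> b" and I: "finite I"
  shows "cmod (\<Sum>i\<in>I. \<Sum>j\<in>I. cinner (A (x i)) (x j) * cinner (B (y i)) (y j)) \<le>
    w * b * Re (\<Sum>i\<in>I. \<Sum>j\<in>I. cinner (x i) (x j) * cinner (y i) (y j))"
    (is "cmod ?L \<le> w * b * Re ?R")
proof -
  have "cmod ?L \<le> c * (w * Re ?R)" if c: "b < c" for c
  proof -
    have "c > 0" using b c by simp
    define C where "C u = complex_of_real (inverse c) *\<^sub>C B u" for u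
    have "clinear C"
      unfolding C_def clinear_def
      by (simp add: clinear_simps[OF B(1)] scaleC_add_right scaleC_scaleC mult.commute)
    moreover have "norm (C u) \<le> (b / c) * norm u" for u
    proof -
      have "norm (C u) = norm (B u) / c"
        using \<open>c > 0\<close> by (simp add: C_def norm_scaleC norm_inverse divide_inverse mult.commute)
      thus ?thesis
        using B(2)[of u] \<open>c > 0\<close> by (simp add: divide_right_mono)
    qed
    ultimately have "cmod (\<Sum>i\<in>I. \<Sum>j\<in>I. cinner (A (x i)) (x j) * cinner (C (y i)) (y j)) \<le> w * Re ?R"
      by (intro strict_contraction_tensor_bound[OF A w _ _ _ _ I, where r = "b / c"])
        (use b c \<open>c > 0\<close> in auto)
    moreover have "(\<Sum>i\<in>I. \<Sum>j\<in>I. cinner (A (x i)) (x j) * cinner (C (y i)) (y j)) =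
        complex_of_real (inverse c) * ?L"
      by (simp add: C_def cinner_scaleC_left sum_distrib_left mult_ac)
    ultimately have "inverse c * cmod ?L \<le> w * Re ?R"
      using \<open>c > 0\<close> by (simp add: norm_mult norm_inverse)
    thus ?thesis using \<open>c > 0\<close> by (simp add: field_simps)
  qed
  moreover have "((\<lambda>c. c * (w * Re ?R)) \<longlongrightarrow> b * (w * Re ?R)) (at_right b)"
    by (intro tendsto_intros)
  ultimately have "cmod ?L \<le> b * (w * Re ?R)"
    by (intro tendsto_lowerbound[where F = "at_right b"])
      (auto simp: eventually_at_right_less intro: eventually_at_rightI[of b "b + 1"])
  thus ?thesis by (simp add: mult_ac)
qed

section \<open>Tensor products\<close>

lemma to_completion_eq_sum_elem_tensor:
  "\<exists>n x y. to_completion t = (\<Sum>i<(n::nat). x i \<otimes>\<^sub>h y i)"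
proof (induction t rule: alg_tensor_induct)
  case 1
  show ?case by (rule exI[of _ 0]) (simp add: clinear_simps[OF clinear_to_completion])
next
  case (2 x0 y0 t)
  then obtain n x y where "to_completion t = (\<Sum>i<(n::nat). x i \<otimes>\<^sub>h y i)" by blast
  hence "to_completion (alg_elem_tensor x0 y0 + t) =
      (\<Sum>i<Suc n. (x(n := x0)) i \<otimes>\<^sub>h (y(n := y0)) i)"
    by (simp add: clinear_simps[OF clinear_to_completion] elem_tensor_def add.commute)
  thus ?case by blast
qed

text \<open>
  Finite sums of elementary tensors are dense and both sides are continuous, so the hypothesis on
  finite double sums is all that has to be known about \<open>A\<close> and \<open>B\<close>. It is symmetric in them, which
  makes one estimate of such sums serve for both terms of the minimum.
\<close>

lemma cinner_tensor_op_bound: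
  assumes A: "bounded_clinear A" and B: "bounded_clinear B"
    and K: "\<And>(n::nat) x y. cmod (\<Sum>i<n. \<Sum>j<n. cinner (A (x i)) (x j) * cinner (B (y i)) (y j)) \<le>
      K * Re (\<Sum>i<n. \<Sum>j<n. cinner (x i) (x j) * cinner (y i) (y j))"
  shows "cmod (cinner (tensor_op A B v) v) \<le> K * (norm v)\<^sup>2"
proof -
  note C = tensor_op(1)[OF A B]
  note lin = clinear_simps[OF bounded_clinear_clinear[OF C]]
  have dense: "cmod (cinner (tensor_op A B (to_completion t)) (to_completion t)) \<le>
      K * (norm (to_completion t))\<^sup>2" for t
  proof -
    obtain n x y where t: "to_completion t = (\<Sum>i<(n::nat). x i \<otimes>\<^sub>h y i)"
      using to_completion_eq_sum_elem_tensor by blast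
    have "tensor_op A B (\<Sum>i<n. x i \<otimes>\<^sub>h y i) = (\<Sum>i<n. A (x i) \<otimes>\<^sub>h B (y i))"
      by (induction n) (simp_all add: lin tensor_op(2)[OF A B])
    hence "cinner (tensor_op A B (to_completion t)) (to_completion t) =
        (\<Sum>i<n. \<Sum>j<n. cinner (A (x i)) (x j) * cinner (B (y i)) (y j))"
      unfolding t by (simp only: cinner_sum_left cinner_sum_right cinner_elem_tensor) (rule sum.swap)
    moreover have "(norm (to_completion t))\<^sup>2 =
        Re (\<Sum>i<n. \<Sum>j<n. cinner (x i) (x j) * cinner (y i) (y j))"
      unfolding norm_sq_eq_Re_cinner t
      by (simp only: cinner_sum_left cinner_sum_right cinner_elem_tensor)
        (rule arg_cong[OF sum.swap])
    ultimately show ?thesis using K[where n = n and x = x and y = y] by simp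
  qed
  obtain X where X: "Cauchy X" "v = abs_hcompletion X" by (rule hcompletion_cases)
  note lim = to_completion_tendsto[OF X(1), folded X(2)]
  show ?thesis
  proof (rule LIMSEQ_le)
    show "(\<lambda>n. cmod (cinner (tensor_op A B (to_completion (X n))) (to_completion (X n)))) \<longlonglongrightarrow>
        cmod (cinner (tensor_op A B v) v)"
      by (intro tendsto_norm tendsto_cinner lim
          bounded_linear.tendsto[OF bounded_clinear_bounded_linear[OF C]])
    show "(\<lambda>n. K * (norm (to_completion (X n)))\<^sup>2) \<longlonglongrightarrow> K * (norm v)\<^sup>2"
      by (intro tendsto_intros lim)
  qed (use dense in blast)
qed

lemma numerical_radius_tensor_op_le:
  assumes A: "bounded_clinear A" and B: "bounded_clinear B"
  shows "numerical_radius (tensor_op A B) \<le>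
      numerical_radius A * (numerical_radius B + numerical_radius_dist B)"
    and "numerical_radius (tensor_op A B) \<le>
      numerical_radius B * (numerical_radius A + numerical_radius_dist A)"
proof -
  note nonneg = numerical_radius_nonneg[OF A] numerical_radius_nonneg[OF B]
    numerical_radius_dist_nonneg[OF A] numerical_radius_dist_nonneg[OF B]
  note bound = tensor_sum_bound[OF bounded_clinear_clinear cmod_cinner_le_numerical_radius
      bounded_clinear_clinear norm_le_numerical_radius_add_dist]
  show "numerical_radius (tensor_op A B) \<le>
      numerical_radius A * (numerical_radius B + numerical_radius_dist B)" (is "_ \<le> ?K")
  proof (rule numerical_radius_leI)
    fix v :: "('a, 'b) htensor"
    assume "norm v = 1"
    moreover have "cmod (cinner (tensor_op A B v) v) \<le> ?K * (norm v)\<^sup>2"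
      by (rule cinner_tensor_op_bound[OF A B bound[OF A A B B]]) (use nonneg in auto)
    ultimately show "cmod (cinner (tensor_op A B v) v) \<le> ?K" by simp
  qed (use nonneg in simp)
  show "numerical_radius (tensor_op A B) \<le>
      numerical_radius B * (numerical_radius A + numerical_radius_dist A)" (is "_ \<le> ?K")
  proof (rule numerical_radius_leI)
    fix v :: "('a, 'b) htensor"
    assume "norm v = 1"
    moreover have "cmod (cinner (tensor_op A B v) v) \<le> ?K * (norm v)\<^sup>2"
    proof (rule cinner_tensor_op_bound[OF A B])
      fix n :: nat and x :: "nat \<Rightarrow> 'a" and y :: "nat \<Rightarrow> 'b"
      show "cmod (\<Sum>i<n. \<Sum>j<n. cinner (A (x i)) (x j) * cinner (B (y i)) (y j)) \<le>
          ?K * Re (\<Sum>i<n. \<Sum>j<n. cinner (x i) (x j) * cinner (y i) (y j))"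
        using bound[OF B B A A, of "{..<n}" y x] nonneg by (simp add: mult.commute)
    qed
    ultimately show "cmod (cinner (tensor_op A B v) v) \<le> ?K" by simp
  qed (use nonneg in simp)
qed

theorem theorem2p1:
  fixes A :: "'a::chilbert_space \<Rightarrow> 'a" and B :: "'b::chilbert_space \<Rightarrow> 'b"
  assumes "bounded_clinear A" and "bounded_clinear B"
  shows "numerical_radius (tensor_op A B) \<le>
      min (numerical_radius A * (numerical_radius B + numerical_radius_dist B))
          (numerical_radius B * (numerical_radius A + numerical_radius_dist A)) \<and>
    min (numerical_radius A * (numerical_radius B + numerical_radius_dist B))
        (numerical_radius B * (numerical_radius A + numerical_radius_dist A)) \<le>
      2 * numerical_radius A * numerical_radius B"
proof -
  have "numerical_radius_dist B \<le> numerical_radius B"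
    using numerical_radius_dist_le[OF assms(2), of 0] by simp
  hence "numerical_radius A * (numerical_radius B + numerical_radius_dist B) \<le>
      numerical_radius A * (numerical_radius B + numerical_radius B)"
    using numerical_radius_nonneg[OF assms(1)] by (intro mult_left_mono) simp_all
  thus ?thesis
    using numerical_radius_tensor_op_le[OF assms] by (simp add: min_le_iff_disj)
qed

end
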